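(* There is an absolute constant $c>0$ such that for all $n$, $\rho\in(0,1]$ and $\epsilon>0$, the sample complexity of the $\rho$-IndepSet property satisfies \[ \mathcal{S}_{\rho\textsc{-IndepSet}}(n,\epsilon) \le c\cdot \frac{\rho^3}{\epsilon^2}\ln^3\!\left(\frac{1}{\epsilon}\right), \] i.e. $\mathcal{S}_{\rho\textsc{-IndepSet}}(n,\epsilon) = O\!\left(\frac{\rho^3}{\epsilon^2}\ln^3(\frac1\epsilon)\right)$.
   Context: Graphs are simple and undirected. The $\rho$-IndepSet property is the set of all graphs on $n$ vertices that contain an independent set on $\rho n$ vertices. A graph $G$ on $n$ vertices is $\epsilon$-far from a property $\Pi$ if at least $\epsilon n^2$ edges must be added to or removed from $G$ to obtain a graph with property $\Pi$. A canonical $\epsilon$-tester for $\Pi$ with sample cost $s$ is a bounded-error randomized algorithm that samples a set $S$ of $s$ vertices of an unknown graph $G$, examines only the induced subgraph $G[S]$, and distinguishes the case that $G$ has $\Pi$ from the case that $G$ is $\epsilon$-far from $\Pi$; bounded error means there are absolute constants $\delta_1>\delta_2$ such that graphs with $\Pi$ are accepted with probability at least $\delta_1$ and graphs $\epsilon$-far from $\Pi$ are accepted with probability at most $\delta_2$. The sample complexity $\mathcal{S}_\Pi(n,\epsilon)$ is the minimum $s$ for which a canonical $\epsilon$-tester for $\Pi$ with sample cost $s$ exists. (Equivalently, by taking complements, the same bound holds for the $\rho$-Clique property: graphs on $n$ vertices containing a clique on $\rho n$ vertices.)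
   Formalization: For ε > 1 the stated bound is negative and so cannot hold; ln(1/ε) is replaced by max(0, ln(1/ε)). The case n = 0, where the empty graph both has the property and is ε-far from it, is excluded, and ρn is rounded up to an integer. *)

theory Defs
  imports "HOL-Probability.Probability"
begin

text \<open>A graph is a pair of a vertex set and a set of edges, each edge being a two-element set of
  vertices.\<close>

type_synonym ugraph = "nat set \<times> nat set set"

abbreviation verts :: "ugraph \<Rightarrow> nat set" where "verts G \<equiv> fst G"
abbreviation edges :: "ugraph \<Rightarrow> nat set set" where "edges G \<equiv> snd G"

definition simple_graph :: "ugraph \<Rightarrow> bool" where
  "simple_graph G \<longleftrightarrow> finite (verts G) \<and> (\<forall>e\<in>edges G. e \<subseteq> verts G \<and> card e = 2)"

definition graphs_on :: "nat \<Rightarrow> ugraph set" where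
  "graphs_on n = {G. simple_graph G \<and> verts G = {..<n}}"

definition induced_subgraph :: "ugraph \<Rightarrow> nat set \<Rightarrow> ugraph" where
  "induced_subgraph G S = (S, {e \<in> edges G. e \<subseteq> S})"

definition independent_set :: "ugraph \<Rightarrow> nat set \<Rightarrow> bool" where
  "independent_set G I \<longleftrightarrow> I \<subseteq> verts G \<and> (\<forall>u\<in>I. \<forall>v\<in>I. {u, v} \<notin> edges G)"

text \<open>The size \<open>\<rho> n\<close> is rounded up when it is not an integer, so that the property asks for an
  independent set on at least \<open>\<rho> n\<close> vertices for every real \<open>\<rho>\<close>.\<close>

definition indep_set_property :: "real \<Rightarrow> ugraph set" where
  "indep_set_property \<rho> =
    {G. simple_graph G \<and>
        (\<exists>I. independent_set G I \<and> card I = nat \<lceil>\<rho> * real (card (verts G))\<rceil>)}"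

definition eps_far :: "real \<Rightarrow> ugraph set \<Rightarrow> ugraph \<Rightarrow> bool" where
  "eps_far \<epsilon> P G \<longleftrightarrow>
    (\<forall>H\<in>P. verts H = verts G \<longrightarrow>
       \<epsilon> * (real (card (verts G)))\<^sup>2 \<le> real (card (sym_diff (edges G) (edges H))))"

text \<open>A tester with sample cost \<open>s\<close> is given by its randomized decision \<open>A\<close> on the induced
  subgraph; the vertex sample is a uniformly random \<open>s\<close>-element set, hence \<open>s \<le> n\<close> below.\<close>

definition accept_prob :: "nat \<Rightarrow> nat \<Rightarrow> (ugraph \<Rightarrow> bool pmf) \<Rightarrow> ugraph \<Rightarrow> real" where
  "accept_prob n s A G =
    pmf (bind_pmf (pmf_of_set {S. S \<subseteq> {..<n} \<and> card S = s})
           (\<lambda>S. A (induced_subgraph G S))) True"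

definition canonical_tester ::
  "real \<Rightarrow> real \<Rightarrow> ugraph set \<Rightarrow> nat \<Rightarrow> real \<Rightarrow> nat \<Rightarrow> (ugraph \<Rightarrow> bool pmf) \<Rightarrow> bool" where
  "canonical_tester \<delta>\<^sub>1 \<delta>\<^sub>2 P n \<epsilon> s A \<longleftrightarrow>
    s \<le> n \<and>
    (\<forall>G\<in>graphs_on n. G \<in> P \<longrightarrow> accept_prob n s A G \<ge> \<delta>\<^sub>1) \<and>
    (\<forall>G\<in>graphs_on n. eps_far \<epsilon> P G \<longrightarrow> accept_prob n s A G \<le> \<delta>\<^sub>2)"

text \<open>The infimum is taken in \<^typ>\<open>enat\<close>, so that it is \<open>\<infinity>\<close> if there is no tester and
  the minimum otherwise.\<close>

definition sample_complexity ::
  "real \<Rightarrow> real \<Rightarrow> ugraph set \<Rightarrow> nat \<Rightarrow> real \<Rightarrow> enat" where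
  "sample_complexity \<delta>\<^sub>1 \<delta>\<^sub>2 P n \<epsilon> =
    Inf (enat ` {s. \<exists>A. canonical_tester \<delta>\<^sub>1 \<delta>\<^sub>2 P n \<epsilon> s A})"

end

theory Submission
  imports Defs
begin

text \<open>
  Let \<open>G\<close> be \<open>\<epsilon>\<close>-far from having an independent set of size \<open>k = \<lceil>\<rho> n\<rceil>\<close>; then every set of at
  least \<open>k\<close> vertices spans at least \<open>D = \<epsilon> n\<^sup>2\<close> edges. Given an independent set \<open>I\<close>, start with
  \<open>C = V\<close> and repeatedly pick the vertex \<open>v\<close> of \<open>I \<inter> C\<close> whose degree in \<open>G[C]\<close> is largest, deleting
  from \<open>C\<close> the vertex \<open>v\<close>, its neighbours and all vertices of larger degree, until \<open>C\<close> spans at most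
  \<open>D / 2\<close> edges. The picked vertices (the fingerprint) determine the final container \<open>K\<close>, which
  contains the rest of \<open>I\<close>.

  Put \<open>w = k - card K\<close>. As long as \<open>C\<close> is large, adding to \<open>K\<close> a random \<open>w\<close>-subset of \<open>C - K\<close> gives
  \<open>k\<close> vertices and so at least \<open>D\<close> edges; since the degrees in \<open>C\<close> are bounded by that of the last
  picked vertex, this forces each pick to remove a fraction of order \<open>D / (w k)\<close> of \<open>C - K\<close>. Hence
  a fingerprint of size \<open>t\<close> has a container with at most \<open>(1 - t \<beta>) k\<close> vertices, where \<open>\<beta>\<close> is of order
  \<open>\<epsilon> / (\<rho>\<^sup>2 ln (1 / \<epsilon>))\<close>: longer fingerprints have smaller containers.

  The tester accepts if the sample contains an independent set of size \<open>\<mu> - 2 \<surd>\<mu>\<close>, where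
  \<open>\<mu> = k s / n\<close>. Chebyshev's inequality gives completeness. For soundness, a container of a fingerprint
  of size \<open>t\<close> must receive about \<open>t \<beta> \<mu>\<close> more sample vertices than expected, which has probability
  \<open>exp (- \<Omega>(t\<^sup>2 \<beta>\<^sup>2 \<mu>))\<close> and so beats the \<open>s ^ t\<close> choices of the fingerprint within the sample as soon
  as \<open>\<beta>\<^sup>2 \<mu>\<close> exceeds a multiple of \<open>ln s\<close>.
\<close>

section \<open>Counting subsets of a given size\<close>

lemma card_subsets_containing:
  assumes "finite V" "A \<subseteq> V" "card A \<le> s"
  shows "card {S. S \<subseteq> V \<and> card S = s \<and> A \<subseteq> S} = (card V - card A) choose (s - card A)"
proof -
  have fA: "finite A" using assms finite_subset by blast
  have "bij_betw (\<lambda>T. T \<union> A) {T. T \<subseteq> V - A \<and> card T = s - card A}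
          {S. S \<subseteq> V \<and> card S = s \<and> A \<subseteq> S}"
  proof (rule bij_betw_byWitness[where f' = "\<lambda>S. S - A"])
    show "(\<lambda>T. T \<union> A) ` {T. T \<subseteq> V - A \<and> card T = s - card A}
            \<subseteq> {S. S \<subseteq> V \<and> card S = s \<and> A \<subseteq> S}"
    proof clarify
      fix T assume T: "T \<subseteq> V - A" "card T = s - card A"
      moreover have "finite T" using T assms(1) finite_subset by blast
      ultimately have "card (T \<union> A) = card T + card A"
        using fA by (intro card_Un_disjoint) auto
      then show "T \<union> A \<subseteq> V \<and> card (T \<union> A) = s \<and> A \<subseteq> T \<union> A"
        using T assms by auto
    qed
    show "(\<lambda>S. S - A) ` {S. S \<subseteq> V \<and> card S = s \<and> A \<subseteq> S}
            \<subseteq> {T. T \<subseteq> V - A \<and> card T = s - card A}"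
      using fA by (auto simp: card_Diff_subset)
  qed auto
  then have "card {S. S \<subseteq> V \<and> card S = s \<and> A \<subseteq> S} = card {T. T \<subseteq> V - A \<and> card T = s - card A}"
    by (simp add: bij_betw_same_card)
  also have "\<dots> = (card V - card A) choose (s - card A)"
    using assms fA by (simp add: n_subsets card_Diff_subset)
  finally show ?thesis .
qed

text \<open>The quotient of the two binomials is the product of (s - i) / (n - i) over i < a, and
  each factor is at most s / n because s \<le> n.\<close>

lemma binomial_diff_le:
  fixes n s a :: nat
  assumes "a \<le> s" "s \<le> n" "1 \<le> n"
  shows "real ((n - a) choose (s - a)) \<le> real (n choose s) * (real s / real n) ^ a"
  using assms(1)
proof (induction a)
  case 0
  then show ?case by simp
next
  case (Suc a)
  let ?q = "\<lambda>a. real ((n - a) choose (s - a))"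
  have eq: "real (n - a) * ?q (Suc a) = real (s - a) * ?q a"
  proof -
    obtain m where m: "n - a = Suc m" using Suc.prems assms by (metis Suc_diff_le Suc_le_D diff_Suc_Suc le_trans)
    obtain l where l: "s - a = Suc l" using Suc.prems by (metis Suc_diff_Suc Suc_le_lessD)
    have "n - Suc a = m" "s - Suc a = l" using m l by auto
    moreover have "Suc l * (Suc m choose Suc l) = Suc m * (m choose l)"
      by (rule Suc_times_binomial)
    ultimately show ?thesis using m l by (metis of_nat_mult)
  qed
  have pos: "real (n - a) > 0" using Suc.prems assms by simp
  have "real n * real (s - a) \<le> real s * real (n - a)"
    using Suc.prems assms by (simp add: of_nat_diff algebra_simps mult_left_mono)
  then have "real n * (real (s - a) * ?q a) \<le> real s * real (n - a) * ?q a"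
    by (metis mult.assoc mult_right_mono of_nat_0_le_iff)
  then have "real (n - a) * (real n * ?q (Suc a)) \<le> real (n - a) * (real s * ?q a)"
    unfolding eq[symmetric] by (simp add: algebra_simps)
  then have "real n * ?q (Suc a) \<le> real s * ?q a"
    using pos by simp
  then have "?q (Suc a) \<le> real s / real n * ?q a"
    using assms(3) by (simp add: field_simps)
  also have "\<dots> \<le> real s / real n * (real (n choose s) * (real s / real n) ^ a)"
    using Suc by (intro mult_left_mono) auto
  finally show ?case by (simp add: algebra_simps)
qed

text \<open>Sampling without replacement is dominated by independent sampling: a random
  \<open>s\<close>-set contains \<open>A\<close> with probability at most (s / |V|)^|A|. The upper
  tail, the variance bound and the random extension in \<open>max_degree_ge_of_large\<close> all
  rest on this.\<close>

lemma card_subsets_containing_le: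
  assumes "finite V" "V \<noteq> {}" "A \<subseteq> V" "s \<le> card V"
  shows "real (card {S. S \<subseteq> V \<and> card S = s \<and> A \<subseteq> S})
      \<le> real (card V choose s) * (real s / real (card V)) ^ card A"
proof (cases "card A \<le> s")
  case True
  have "1 \<le> card V" using assms by (simp add: Suc_leI card_gt_0_iff)
  then show ?thesis
    using card_subsets_containing[OF assms(1,3) True] binomial_diff_le[OF True assms(4)] by simp
next
  case False
  then have "{S. S \<subseteq> V \<and> card S = s \<and> A \<subseteq> S} = {}"
    using assms(1) by (auto dest: card_mono finite_subset)
  then have "card {S. S \<subseteq> V \<and> card S = s \<and> A \<subseteq> S} = 0" by (simp only: card.empty)
  then show ?thesis by simp
qed

lemma card_subsets_containing_point:
  assumes "finite V" "v \<in> V" "s \<le> card V"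
  shows "real (card {S. S \<subseteq> V \<and> card S = s \<and> v \<in> S})
      = real (card V choose s) * (real s / real (card V))"
proof (cases s)
  case 0
  then have "{S. S \<subseteq> V \<and> card S = s \<and> v \<in> S} = {}"
    using assms(1) by (auto dest: finite_subset)
  then have "card {S. S \<subseteq> V \<and> card S = s \<and> v \<in> S} = 0" by (simp only: card.empty)
  then show ?thesis using 0 by simp
next
  case (Suc l)
  obtain m where m: "card V = Suc m" using assms(1,2) by (metis card_Suc_Diff1)
  have "card {S. S \<subseteq> V \<and> card S = s \<and> v \<in> S} = m choose l"
    using card_subsets_containing[of V "{v}" s] assms Suc m by simp
  moreover have "real (Suc l) * real (Suc m choose Suc l) = real (Suc m) * real (m choose l)"
    by (metis Suc_times_binomial of_nat_mult)
  ultimately show ?thesis using Suc m by (simp add: field_simps)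
qed

section \<open>Exponential moments and the upper tail\<close>

lemma sum_Pow_power_card:
  fixes z :: real
  assumes "finite A"
  shows "(\<Sum>J\<in>Pow A. z ^ card J) = (1 + z) ^ card A"
  using prod_add[OF assms, of "\<lambda>_. z" "\<lambda>_. 1"] by (simp add: add.commute)

text \<open>Expand (1 + z)^|S \<inter> C| as the sum of z^|J| over J \<subseteq> S \<inter> C and
  exchange the sums. Each F \<union> J lies in at most a fraction r^(|F| + |J|) of the samples, r =
  s / |V|, and the sum over J folds back to (1 + z r)^|C|.\<close>

lemma sum_power_inter_le:
  fixes z :: real
  assumes V: "finite V" "V \<noteq> {}" "s \<le> card V" and F: "F \<subseteq> V" and C: "C \<subseteq> V" "C \<inter> F = {}"
    and z: "0 \<le> z"
  shows "(\<Sum>S\<in>{S. S \<subseteq> V \<and> card S = s \<and> F \<subseteq> S}. (1 + z) ^ card (S \<inter> C))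
     \<le> real (card V choose s) * (real s / real (card V)) ^ card F
         * exp (z * (real s / real (card V)) * real (card C))"
proof -
  define r where "r = real s / real (card V)"
  define N where "N = real (card V choose s)"
  let ?SS = "{S. S \<subseteq> V \<and> card S = s \<and> F \<subseteq> S}"
  have r: "0 \<le> r" by (simp add: r_def)
  have fin: "finite ?SS" using V by simp
  have fC: "finite C" "finite F" using C F V finite_subset by blast+
  have "(\<Sum>S\<in>?SS. (1 + z) ^ card (S \<inter> C)) = (\<Sum>S\<in>?SS. \<Sum>J\<in>{J\<in>Pow C. J \<subseteq> S}. z ^ card J)"
  proof (rule sum.cong[OF refl])
    fix S
    have "{J\<in>Pow C. J \<subseteq> S} = Pow (S \<inter> C)" by auto
    then show "(1 + z) ^ card (S \<inter> C) = (\<Sum>J\<in>{J\<in>Pow C. J \<subseteq> S}. z ^ card J)"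
      using sum_Pow_power_card[of "S \<inter> C" z] fC by simp
  qed
  also have "\<dots> = (\<Sum>J\<in>Pow C. \<Sum>S\<in>{S\<in>?SS. J \<subseteq> S}. z ^ card J)"
    using fin fC by (intro sum.swap_restrict) auto
  also have "\<dots> = (\<Sum>J\<in>Pow C. z ^ card J * real (card {S. S \<subseteq> V \<and> card S = s \<and> (F \<union> J) \<subseteq> S}))"
  proof (rule sum.cong[OF refl])
    fix J
    have "{S\<in>?SS. J \<subseteq> S} = {S. S \<subseteq> V \<and> card S = s \<and> (F \<union> J) \<subseteq> S}" by auto
    then show "(\<Sum>S\<in>{S\<in>?SS. J \<subseteq> S}. z ^ card J)
        = z ^ card J * real (card {S. S \<subseteq> V \<and> card S = s \<and> (F \<union> J) \<subseteq> S})" by simp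
  qed
  also have "\<dots> \<le> (\<Sum>J\<in>Pow C. z ^ card J * (N * r ^ (card F + card J)))"
  proof (intro sum_mono mult_left_mono)
    fix J assume J: "J \<in> Pow C"
    then have "finite J" using fC finite_subset by auto
    then have "card (F \<union> J) = card F + card J" using J C fC by (intro card_Un_disjoint) auto
    then show "real (card {S. S \<subseteq> V \<and> card S = s \<and> (F \<union> J) \<subseteq> S}) \<le> N * r ^ (card F + card J)"
      using card_subsets_containing_le[of V "F \<union> J" s] V F C J by (auto simp: N_def r_def)
  qed (use z in auto)
  also have "\<dots> = N * r ^ card F * (\<Sum>J\<in>Pow C. (z * r) ^ card J)"
    by (simp add: sum_distrib_left power_add power_mult_distrib algebra_simps)
  also have "\<dots> = N * r ^ card F * (1 + z * r) ^ card C"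
    using fC by (simp add: sum_Pow_power_card)
  also have "\<dots> \<le> N * r ^ card F * exp (z * r) ^ card C"
    using z r by (intro mult_left_mono power_mono exp_ge_add_one_self) (auto simp: N_def)
  also have "\<dots> = N * r ^ card F * exp (z * r * real (card C))"
    by (simp add: exp_of_nat_mult[symmetric] mult.commute)
  finally show ?thesis by (simp add: N_def r_def)
qed

text \<open>Markov's inequality for (1 + z)^|S \<inter> C|. Forcing the fingerprint \<open>F\<close>
  into the sample contributes the factor (s / |V|)^|F|; \<open>z\<close> stays free and is chosen in
  \<open>tail_exponent_le\<close>.\<close>

lemma card_upper_tail_le:
  fixes z M :: real
  assumes V: "finite V" "V \<noteq> {}" "s \<le> card V" and F: "F \<subseteq> V" and C: "C \<subseteq> V" "C \<inter> F = {}"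
    and z: "0 \<le> z"
  shows "real (card {S. S \<subseteq> V \<and> card S = s \<and> F \<subseteq> S \<and> M \<le> real (card (S \<inter> C))})
     \<le> real (card V choose s) * (real s / real (card V)) ^ card F
         * exp (z * (real s / real (card V)) * real (card C) - M * ln (1 + z))"
proof -
  let ?SS = "{S. S \<subseteq> V \<and> card S = s \<and> F \<subseteq> S}"
  let ?T = "{S. S \<subseteq> V \<and> card S = s \<and> F \<subseteq> S \<and> M \<le> real (card (S \<inter> C))}"
  have "real (card ?T) * exp (M * ln (1 + z)) = (\<Sum>S\<in>?T. exp (M * ln (1 + z)))" by simp
  also have "\<dots> \<le> (\<Sum>S\<in>?T. (1 + z) ^ card (S \<inter> C))"
  proof (rule sum_mono)
    fix S assume "S \<in> ?T"
    then have "exp (M * ln (1 + z)) \<le> exp (real (card (S \<inter> C)) * ln (1 + z))"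
      using z by (auto intro!: mult_right_mono)
    also have "\<dots> = (1 + z) ^ card (S \<inter> C)" using z by (simp add: exp_of_nat_mult)
    finally show "exp (M * ln (1 + z)) \<le> (1 + z) ^ card (S \<inter> C)" .
  qed
  also have "\<dots> \<le> (\<Sum>S\<in>?SS. (1 + z) ^ card (S \<inter> C))"
    using V z by (intro sum_mono2) auto
  also note sum_power_inter_le[OF assms]
  finally have "real (card ?T) \<le> real (card V choose s) * (real s / real (card V)) ^ card F
      * exp (z * (real s / real (card V)) * real (card C)) / exp (M * ln (1 + z))"
    by (subst pos_le_divide_eq) auto
  then show ?thesis by (simp add: exp_diff)
qed

section \<open>Second moment and the lower tail\<close>

lemma sum_card_inter:
  assumes "finite \<S>" "finite I"
  shows "(\<Sum>S\<in>\<S>. real (card (S \<inter> I))) = (\<Sum>v\<in>I. real (card {S\<in>\<S>. v \<in> S}))"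
proof -
  have "(\<Sum>S\<in>\<S>. real (card (S \<inter> I))) = (\<Sum>S\<in>\<S>. \<Sum>v\<in>{v\<in>I. v \<in> S}. 1)"
    by (intro sum.cong) (auto simp: Int_def conj_commute)
  also have "\<dots> = (\<Sum>v\<in>I. \<Sum>S\<in>{S\<in>\<S>. v \<in> S}. 1)"
    using assms by (intro sum.swap_restrict) auto
  finally show ?thesis by simp
qed

lemma sum_card_inter_squared:
  assumes "finite \<S>" "finite I"
  shows "(\<Sum>S\<in>\<S>. (real (card (S \<inter> I)))\<^sup>2) = (\<Sum>u\<in>I. \<Sum>v\<in>I. real (card {S\<in>\<S>. {u, v} \<subseteq> S}))"
proof -
  have "(\<Sum>S\<in>\<S>. (real (card (S \<inter> I)))\<^sup>2) = (\<Sum>S\<in>\<S>. \<Sum>p\<in>{p\<in>I \<times> I. {fst p, snd p} \<subseteq> S}. 1)"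
  proof (rule sum.cong[OF refl])
    fix S
    have "{p\<in>I \<times> I. {fst p, snd p} \<subseteq> S} = (S \<inter> I) \<times> (S \<inter> I)" by auto
    then show "(real (card (S \<inter> I)))\<^sup>2 = (\<Sum>p\<in>{p\<in>I \<times> I. {fst p, snd p} \<subseteq> S}. 1)"
      by (simp add: card_cartesian_product power2_eq_square)
  qed
  also have "\<dots> = (\<Sum>p\<in>I \<times> I. \<Sum>S\<in>{S\<in>\<S>. {fst p, snd p} \<subseteq> S}. 1)"
    using assms by (intro sum.swap_restrict) auto
  also have "\<dots> = (\<Sum>(u, v)\<in>I \<times> I. real (card {S\<in>\<S>. {u, v} \<subseteq> S}))"
    by (intro sum.cong) auto
  also have "\<dots> = (\<Sum>u\<in>I. \<Sum>v\<in>I. real (card {S\<in>\<S>. {u, v} \<subseteq> S}))"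
    by (rule sum.cartesian_product[symmetric])
  finally show ?thesis .
qed

text \<open>Distinct vertices are negatively correlated, so off-diagonal pairs add at most the
  square of the mean and only the diagonal is left, which adds \<mu>.\<close>

lemma sum_card_inter_variance_le:
  assumes V: "finite V" "V \<noteq> {}" "s \<le> card V" and I: "I \<subseteq> V"
  defines "\<mu> \<equiv> real (card I) * real s / real (card V)"
  shows "(\<Sum>S\<in>{S. S \<subseteq> V \<and> card S = s}. (real (card (S \<inter> I)) - \<mu>)\<^sup>2)
     \<le> real (card V choose s) * \<mu>"
proof -
  let ?SS = "{S. S \<subseteq> V \<and> card S = s}"
  define N where "N = real (card V choose s)"
  define r where "r = real s / real (card V)"
  have fin: "finite ?SS" "finite I" using V I finite_subset by auto
  have \<mu>: "\<mu> = real (card I) * r" by (simp add: \<mu>_def r_def)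
  have cN: "real (card ?SS) = N" using n_subsets[OF V(1)] by (simp add: N_def)
  have e1: "(\<Sum>S\<in>?SS. real (card (S \<inter> I))) = N * \<mu>"
  proof -
    have "real (card {S\<in>?SS. v \<in> S}) = N * r" if "v \<in> I" for v
      using card_subsets_containing_point[of V v s] V I that
      by (auto simp: N_def r_def conj_assoc)
    then show ?thesis by (simp add: sum_card_inter[OF fin] \<mu>)
  qed
  have e2: "(\<Sum>S\<in>?SS. (real (card (S \<inter> I)))\<^sup>2) \<le> N * \<mu> + N * \<mu>\<^sup>2"
  proof -
    have *: "real (card {S\<in>?SS. {u, v} \<subseteq> S}) \<le> N * r\<^sup>2 + (if u = v then N * r else 0)"
      if "u \<in> I" "v \<in> I" for u v
    proof -
      have "real (card {S\<in>?SS. {u, v} \<subseteq> S}) \<le> N * r ^ card {u, v}"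
        using card_subsets_containing_le[of V "{u, v}" s] V I that
        by (auto simp: N_def r_def conj_assoc)
      moreover have "0 \<le> N * r\<^sup>2" by (simp add: N_def)
      ultimately show ?thesis by (cases "u = v") (auto simp: power2_eq_square)
    qed
    have "(\<Sum>S\<in>?SS. (real (card (S \<inter> I)))\<^sup>2)
        \<le> (\<Sum>u\<in>I. \<Sum>v\<in>I. N * r\<^sup>2 + (if u = v then N * r else 0))"
      unfolding sum_card_inter_squared[OF fin] by (intro sum_mono *)
    also have "\<dots> = N * \<mu> + N * \<mu>\<^sup>2"
      using fin by (simp add: sum.distrib \<mu> power2_eq_square algebra_simps)
    finally show ?thesis .
  qed
  have "(\<Sum>S\<in>?SS. (real (card (S \<inter> I)) - \<mu>)\<^sup>2)
      = (\<Sum>S\<in>?SS. (real (card (S \<inter> I)))\<^sup>2) - 2 * \<mu> * (\<Sum>S\<in>?SS. real (card (S \<inter> I))) + N * \<mu>\<^sup>2"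
    by (simp add: power2_diff sum.distrib sum_subtractf cN[symmetric] sum_distrib_left algebra_simps)
  then show ?thesis using e1 e2 by (simp add: N_def power2_eq_square algebra_simps)
qed

text \<open>Chebyshev's inequality: the variance is at most \<mu> and the deviation is 2 sqrt \<mu>,
  hence the fraction 1/4.\<close>

lemma card_lower_tail_le:
  assumes V: "finite V" "V \<noteq> {}" "s \<le> card V" and I: "I \<subseteq> V"
  defines "\<mu> \<equiv> real (card I) * real s / real (card V)"
  assumes pos: "0 < \<mu>"
  shows "real (card {S. S \<subseteq> V \<and> card S = s \<and> real (card (S \<inter> I)) < \<mu> - 2 * sqrt \<mu>})
     \<le> real (card V choose s) / 4"
proof -
  let ?SS = "{S. S \<subseteq> V \<and> card S = s}"
  let ?T = "{S. S \<subseteq> V \<and> card S = s \<and> real (card (S \<inter> I)) < \<mu> - 2 * sqrt \<mu>}"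
  have "real (card ?T) * (4 * \<mu>) = (\<Sum>S\<in>?T. 4 * \<mu>)" by simp
  also have "\<dots> \<le> (\<Sum>S\<in>?T. (real (card (S \<inter> I)) - \<mu>)\<^sup>2)"
  proof (rule sum_mono)
    fix S assume "S \<in> ?T"
    then have "(2 * sqrt \<mu>)\<^sup>2 \<le> (\<mu> - real (card (S \<inter> I)))\<^sup>2"
      using pos by (intro power_mono) auto
    then show "4 * \<mu> \<le> (real (card (S \<inter> I)) - \<mu>)\<^sup>2"
      using pos by (simp add: power_mult_distrib power2_commute)
  qed
  also have "\<dots> \<le> (\<Sum>S\<in>?SS. (real (card (S \<inter> I)) - \<mu>)\<^sup>2)"
    using V by (intro sum_mono2) auto
  also have "\<dots> \<le> real (card V choose s) * \<mu>"
    unfolding \<mu>_def by (rule sum_card_inter_variance_le[OF V I])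
  finally show ?thesis using pos by (simp add: field_simps)
qed

section \<open>Graph containers\<close>

text \<open>The form in which farness is used: \<open>D\<close> stands for \<epsilon> n^2 and
  \<open>k\<close> for the size of the desired independent set. The instance comes from
  \<open>eps_far_locally_dense\<close>.\<close>

locale locally_dense_graph =
  fixes V :: "'a set" and E :: "'a set set" and k :: nat and D :: real
  assumes finite_V: "finite V"
    and edge: "e \<in> E \<Longrightarrow> e \<subseteq> V \<and> card e = 2"
    and k_le: "k \<le> card V"
    and D_pos: "0 < D"
    and dense: "U \<subseteq> V \<Longrightarrow> k \<le> card U \<Longrightarrow> D \<le> real (card {e\<in>E. e \<subseteq> U})"
begin

section \<open>Degrees and edge counts inside a vertex set\<close>

definition deg_in :: "'a set \<Rightarrow> 'a \<Rightarrow> nat" where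
  "deg_in C u = card {e\<in>E. e \<subseteq> C \<and> u \<in> e}"

lemma finite_E: "finite E"
  using finite_V edge by (intro finite_subset[of E "Pow V"]) auto

lemma deg_in_mono: "C \<subseteq> C' \<Longrightarrow> deg_in C u \<le> deg_in C' u"
  unfolding deg_in_def using finite_E by (intro card_mono) auto

lemma deg_in_le_card_neighbours:
  assumes "finite C"
  shows "deg_in C u \<le> card {x\<in>C. {x, u} \<in> E}"
proof -
  have "{e\<in>E. e \<subseteq> C \<and> u \<in> e} \<subseteq> (\<lambda>x. {x, u}) ` {x\<in>C. {x, u} \<in> E}"
  proof
    fix e assume e: "e \<in> {e\<in>E. e \<subseteq> C \<and> u \<in> e}"
    then have "card e = 2" using edge by blast
    then obtain x y where "e = {x, y}" by (auto simp: card_2_iff)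
    then show "e \<in> (\<lambda>x. {x, u}) ` {x\<in>C. {x, u} \<in> E}"
      using e by (auto simp: insert_commute)
  qed
  then show ?thesis unfolding deg_in_def using assms by (intro surj_card_le) auto
qed

lemma card_edges_meeting_le:
  assumes "finite X" "\<And>u. u \<in> X \<Longrightarrow> deg_in C u \<le> d"
  shows "card {e\<in>E. e \<subseteq> C \<and> e \<inter> X \<noteq> {}} \<le> card X * d"
proof -
  have "card {e\<in>E. e \<subseteq> C \<and> e \<inter> X \<noteq> {}} = card (\<Union>u\<in>X. {e\<in>E. e \<subseteq> C \<and> u \<in> e})"
    by (rule arg_cong[where f = card]) auto
  also have "\<dots> \<le> (\<Sum>u\<in>X. card {e\<in>E. e \<subseteq> C \<and> u \<in> e})"
    using assms(1) by (rule card_UN_le)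
  also have "\<dots> \<le> (\<Sum>u\<in>X. d)"
    using assms(2) by (intro sum_mono) (auto simp: deg_in_def)
  finally show ?thesis by simp
qed

lemma card_sparse_less:
  assumes "K \<subseteq> V" "real (card {e\<in>E. e \<subseteq> K}) \<le> D / 2"
  shows "card K < k"
  using dense[of K] assms D_pos by (cases "k \<le> card K") auto

text \<open>Extend \<open>K\<close> to a set \<open>U\<close> of \<open>k\<close> vertices. At least
  D / 2 edges of \<open>U\<close> must meet U - K, and each of its k - |K| vertices has degree at
  most \<open>k\<close> in \<open>U\<close>.\<close>

lemma sparse_deficit_ge:
  assumes K: "K \<subseteq> V" "real (card {e\<in>E. e \<subseteq> K}) \<le> D / 2"
  shows "D \<le> 2 * real (k - card K) * real k"
proof -
  have "card K < k" using card_sparse_less[OF K] .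
  then obtain U where U: "K \<subseteq> U" "U \<subseteq> V" "card U = k"
    using exists_subset_between[of K k V] K k_le finite_V by auto
  have fU: "finite U" "finite K" using U K finite_V finite_subset by blast+
  have "deg_in U u \<le> k" for u
    using deg_in_le_card_neighbours[OF fU(1), of u] card_mono[of U "{x\<in>U. {x, u} \<in> E}"] U fU
    by auto
  then have "card {e\<in>E. e \<subseteq> U \<and> e \<inter> (U - K) \<noteq> {}} \<le> card (U - K) * k"
    using fU by (intro card_edges_meeting_le) auto
  also have "card (U - K) = k - card K" using U fU by (simp add: card_Diff_subset)
  finally have 1: "card {e\<in>E. e \<subseteq> U \<and> e \<inter> (U - K) \<noteq> {}} \<le> (k - card K) * k" .
  have "{e\<in>E. e \<subseteq> U} \<subseteq> {e\<in>E. e \<subseteq> K} \<union> {e\<in>E. e \<subseteq> U \<and> e \<inter> (U - K) \<noteq> {}}" by auto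
  then have "card {e\<in>E. e \<subseteq> U} \<le> card ({e\<in>E. e \<subseteq> K} \<union> {e\<in>E. e \<subseteq> U \<and> e \<inter> (U - K) \<noteq> {}})"
    using finite_E by (intro card_mono) auto
  also have "\<dots> \<le> card {e\<in>E. e \<subseteq> K} + card {e\<in>E. e \<subseteq> U \<and> e \<inter> (U - K) \<noteq> {}}"
    by (rule card_Un_le)
  finally have "card {e\<in>E. e \<subseteq> U} \<le> card {e\<in>E. e \<subseteq> K} + (k - card K) * k"
    using 1 by linarith
  then have "real (card {e\<in>E. e \<subseteq> U}) \<le> real (card {e\<in>E. e \<subseteq> K}) + real (k - card K) * real k"
    by (simp only: of_nat_le_iff flip: of_nat_add of_nat_mult)
  moreover have "D \<le> real (card {e\<in>E. e \<subseteq> U})" using dense[of U] U by simp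
  ultimately show ?thesis using K(2) by linarith
qed

text \<open>Averaging over a uniformly random \<open>w\<close>-subset \<open>W\<close> of Y = C - K,
  w = k - |K|: the union of \<open>K\<close> and \<open>W\<close> has \<open>k\<close> vertices and
  so spans at least \<open>D\<close> edges, while with r = w / |Y| the expected number is at most D
  / 2 + r d |K| + r^2 d |Y| = D / 2 + r d k.\<close>

lemma max_degree_ge_of_large:
  assumes C: "C \<subseteq> V" "k \<le> card C" and K: "K \<subseteq> C" "real (card {e\<in>E. e \<subseteq> K}) \<le> D / 2"
    and deg: "\<And>u. u \<in> C \<Longrightarrow> deg_in C u \<le> d"
  shows "D * real (card (C - K)) \<le> 2 * real (k - card K) * real k * real d"
proof -
  define Y where "Y = C - K"
  define y where "y = card Y"
  define w where "w = k - card K"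
  define r where "r = real w / real y"
  let ?SS = "{W. W \<subseteq> Y \<and> card W = w}"
  let ?EC = "{e\<in>E. e \<subseteq> C}"
  have fC: "finite C" "finite K" "finite Y"
    using C K finite_V finite_subset by (auto simp: Y_def intro: finite_subset)
  have Kk: "card K < k" using card_sparse_less[of K] C K by auto
  have y: "y = card C - card K" using fC K by (simp add: y_def Y_def card_Diff_subset)
  have wy: "w \<le> y" "0 < w" using y C Kk by (auto simp: w_def)
  have r: "0 \<le> r" "r * real y = real w" using wy by (auto simp: r_def)
  have NY: "Y \<noteq> {}" using wy by (auto simp: y_def)
  define N where "N = real (y choose w)"
  have N: "N > 0" using wy by (simp add: N_def)
  have fSS: "finite ?SS" using fC by simp
  have "N * D = (\<Sum>W\<in>?SS. D)" using n_subsets[OF fC(3), of w] by (simp add: N_def y_def)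
  \<comment> \<open>An edge of \<open>C\<close> lies in the union of \<open>K\<close> and
    \<open>W\<close> exactly when its endpoints outside \<open>K\<close> lie in
    \<open>W\<close>.\<close>
  also have "\<dots> \<le> (\<Sum>W\<in>?SS. \<Sum>e\<in>{e\<in>?EC. e - K \<subseteq> W}. 1)"
  proof (rule sum_mono)
    fix W assume W: "W \<in> ?SS"
    then have fW: "finite W" using fC finite_subset by auto
    have "card (K \<union> W) = card K + card W"
      using W fC fW by (intro card_Un_disjoint) (auto simp: Y_def)
    then have "card (K \<union> W) = k" using W Kk by (simp add: w_def)
    moreover have "{e\<in>E. e \<subseteq> K \<union> W} = {e\<in>?EC. e - K \<subseteq> W}"
      using W K by (auto simp: Y_def)
    moreover have "K \<union> W \<subseteq> V" using W K C by (auto simp: Y_def)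
    ultimately show "D \<le> (\<Sum>e\<in>{e\<in>?EC. e - K \<subseteq> W}. 1)"
      using dense[of "K \<union> W"] by simp
  qed
  also have "\<dots> = (\<Sum>e\<in>?EC. \<Sum>W\<in>{W\<in>?SS. e - K \<subseteq> W}. 1)"
    using fSS finite_E by (intro sum.swap_restrict) auto
  also have "\<dots> \<le> (\<Sum>e\<in>?EC. N * r ^ card (e - K))"
  proof (rule sum_mono)
    fix e assume "e \<in> ?EC"
    then have "e - K \<subseteq> Y" by (auto simp: Y_def)
    then show "(\<Sum>W\<in>{W\<in>?SS. e - K \<subseteq> W}. 1) \<le> N * r ^ card (e - K)"
      using card_subsets_containing_le[of Y "e - K" w] fC NY wy
      by (simp add: N_def r_def y_def conj_assoc)
  qed
  also have "\<dots> = N * (\<Sum>e\<in>?EC. r ^ card (e - K))" by (simp add: sum_distrib_left)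
  finally have "D \<le> (\<Sum>e\<in>?EC. r ^ card (e - K))" using N by simp
  \<comment> \<open>An edge with 0, 1 or 2 endpoints outside \<open>K\<close> survives with
    probability at most 1, r or r^2; each case is charged to one of the three terms.\<close>
  also have "\<dots> \<le> (\<Sum>e\<in>?EC. of_bool (e \<subseteq> K) + r * of_bool (e \<inter> K \<noteq> {})
                       + r\<^sup>2 * of_bool (e \<inter> Y \<noteq> {}))"
  proof (rule sum_mono)
    fix e assume e: "e \<in> ?EC"
    then have "card e = 2" using edge by blast
    then obtain a b where ab: "e = {a, b}" "a \<noteq> b" by (auto simp: card_2_iff)
    have "a \<in> C" "b \<in> C" using e ab by auto
    then show "r ^ card (e - K)
        \<le> of_bool (e \<subseteq> K) + r * of_bool (e \<inter> K \<noteq> {}) + r\<^sup>2 * of_bool (e \<inter> Y \<noteq> {})"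
      using ab r(1)
      by (cases "a \<in> K"; cases "b \<in> K") (auto simp: Y_def insert_Diff_if power2_eq_square)
  qed
  also have "\<dots> = real (card {e\<in>?EC. e \<subseteq> K}) + r * real (card {e\<in>?EC. e \<inter> K \<noteq> {}})
                   + r\<^sup>2 * real (card {e\<in>?EC. e \<inter> Y \<noteq> {}})"
    using finite_E by (simp add: sum.distrib sum_distrib_left[symmetric] Int_def)
  also have "\<dots> \<le> D / 2 + r * (real (card K) * real d) + r\<^sup>2 * (real y * real d)"
  proof (intro add_mono mult_left_mono)
    have "{e\<in>?EC. e \<subseteq> K} = {e\<in>E. e \<subseteq> K}" using K by auto
    then show "real (card {e\<in>?EC. e \<subseteq> K}) \<le> D / 2" using K by simp
    have "card {e\<in>E. e \<subseteq> C \<and> e \<inter> K \<noteq> {}} \<le> card K * d"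
      using fC K by (intro card_edges_meeting_le deg) auto
    then show "real (card {e\<in>?EC. e \<inter> K \<noteq> {}}) \<le> real (card K) * real d"
      by (simp add: conj_assoc flip: of_nat_mult)
    have "card {e\<in>E. e \<subseteq> C \<and> e \<inter> Y \<noteq> {}} \<le> card Y * d"
      using fC by (intro card_edges_meeting_le deg) (auto simp: Y_def)
    then show "real (card {e\<in>?EC. e \<inter> Y \<noteq> {}}) \<le> real y * real d"
      by (simp add: conj_assoc y_def flip: of_nat_mult)
  qed (use r in auto)
  also have "\<dots> = D / 2 + r * real d * (real (card K) + r * real y)"
    by (simp add: algebra_simps power2_eq_square)
  also have "\<dots> = D / 2 + r * real d * real k"
    using Kk unfolding r(2) by (simp add: w_def of_nat_diff)
  finally have "D * real y \<le> 2 * (r * real y) * real d * real k"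
    using wy by (simp add: mult_right_mono mult.commute mult.left_commute)
  then show ?thesis unfolding r(2) by (simp add: y_def Y_def w_def algebra_simps)
qed

text \<open>If |C| \<ge> k the random extension applies, and |C - K| \<ge> w. Otherwise D / 2 < |C|
  d \<le> k d, and |C - K| \<le> w. The added summand \<open>w\<close> = k - |K| covers both cases
  and keeps the potential in \<open>container_shrinks\<close> at least \<open>w\<close>.\<close>

lemma max_degree_ge:
  assumes C: "C \<subseteq> V" "D / 2 < real (card {e\<in>E. e \<subseteq> C})"
    and K: "K \<subseteq> C" "real (card {e\<in>E. e \<subseteq> K}) \<le> D / 2"
    and deg: "\<And>u. u \<in> C \<Longrightarrow> deg_in C u \<le> d"
  shows "D * real (card (C - K) + (k - card K)) \<le> 4 * real (k - card K) * real k * real d"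
proof -
  define w where "w = k - card K"
  have fC: "finite C" using C(1) finite_V by (rule finite_subset)
  then have fK: "finite K" using K(1) finite_subset by blast
  have Kk: "card K < k" using card_sparse_less[of K] C K by auto
  have y: "card (C - K) = card C - card K" using fK K by (simp add: card_Diff_subset)
  show ?thesis
  proof (cases "k \<le> card C")
    case True
    have "w \<le> card (C - K)" using y True by (simp add: w_def diff_le_mono)
    then have "D * (real (card (C - K)) + real w) \<le> D * (2 * real (card (C - K)))"
      using D_pos by (intro mult_left_mono) auto
    also have "\<dots> \<le> 4 * real w * real k * real d"
      using max_degree_ge_of_large[OF C(1) True K deg] unfolding w_def by linarith
    finally show ?thesis unfolding w_def of_nat_add .
  next
    case False
    have "{e\<in>E. e \<subseteq> C \<and> e \<inter> C \<noteq> {}} = {e\<in>E. e \<subseteq> C}"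
    proof -
      have "e \<noteq> {}" if "e \<in> E" for e using edge[OF that] by auto
      then show ?thesis by blast
    qed
    then have "card {e\<in>E. e \<subseteq> C} \<le> card C * d"
      using card_edges_meeting_le[OF fC deg] by simp
    also have "\<dots> \<le> k * d" using False by simp
    finally have "D \<le> 2 * (real k * real d)"
      using C(2) by (simp flip: of_nat_mult)
    moreover have "card (C - K) \<le> w" using y False by (simp add: w_def diff_le_mono)
    then have "D * (real (card (C - K)) + real w) \<le> D * (2 * real w)"
      using D_pos by (intro mult_left_mono) auto
    moreover have "D * (2 * real w) \<le> 2 * (real k * real d) * (2 * real w)"
      using calculation(1) by (intro mult_right_mono) auto
    ultimately have "D * (real (card (C - K)) + real w) \<le> 2 * (real k * real d) * (2 * real w)"
      by linarith
    then show ?thesis unfolding w_def of_nat_add by (simp only: mult_ac)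
  qed
qed

section \<open>The container algorithm\<close>

definition step :: "'a set \<Rightarrow> 'a \<Rightarrow> 'a set" where
  "step C v = {u\<in>C. u \<noteq> v \<and> {u, v} \<notin> E \<and> deg_in C u \<le> deg_in C v}"

text \<open>Since \<open>step\<close> also drops the vertices of larger degree, the degree of the
  picked vertex bounds every remaining degree; it serves as the \<open>d\<close> of
  \<open>max_degree_ge\<close>.\<close>

lemma deg_in_step: "u \<in> step C v \<Longrightarrow> deg_in (step C v) u \<le> deg_in C v"
  using deg_in_mono[of "step C v" C u] by (auto simp: step_def)

lemma card_step_le:
  assumes "finite C" "K \<subseteq> step C v"
  shows "card (step C v - K) + deg_in C v \<le> card (C - K)"
proof -
  let ?N = "{x\<in>C. {x, v} \<in> E}"
  have "card (step C v - K) + card ?N = card ((step C v - K) \<union> ?N)"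
    using assms by (intro card_Un_disjoint[symmetric]) (auto simp: step_def)
  also have "\<dots> \<le> card (C - K)"
    using assms by (intro card_mono) (auto simp: step_def)
  finally show ?thesis using deg_in_le_card_neighbours[OF assms(1), of v] by linarith
qed

text \<open>The most recent vertex of the fingerprint is at the head of the list.\<close>

fun container :: "'a list \<Rightarrow> 'a set" where
  "container [] = V"
| "container (v # vs) = step (container vs) v"

text \<open>States that the process has not stopped: every container reached after a pick is still
  dense. The initial set V spans at least \<open>D\<close> edges by \<open>dense\<close>, so a first
  pick is always made.\<close>

fun run :: "'a list \<Rightarrow> bool" where
  "run [] \<longleftrightarrow> True"
| "run (v # vs) \<longleftrightarrow> run vs \<and> D / 2 < real (card {e\<in>E. e \<subseteq> container (v # vs)})"

lemma container_subset: "container vs \<subseteq> V"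
  by (induction vs) (auto simp: step_def)

lemma container_disjoint: "container vs \<inter> set vs = {}"
  by (induction vs) (auto simp: step_def)

text \<open>The potential |C - K| + w, w = k - |K|, drops by a factor 1 + b per pick, b = D / (4 w
  k): a pick removes at least deg(v) vertices outside \<open>K\<close>, and
  \<open>max_degree_ge\<close>, applied to the new container, bounds deg(v) below by b times the new
  potential.\<close>

lemma container_shrinks:
  assumes K: "real (card {e\<in>E. e \<subseteq> K}) \<le> D / 2" and "run vs" "K \<subseteq> container vs"
  shows "(1 + D / (4 * real (k - card K) * real k)) ^ length vs
           * real (card (container vs - K) + (k - card K)) \<le> real (card V + k)"
  using assms(2,3)
proof (induction vs)
  case Nil
  have "card (V - K) \<le> card V" using finite_V by (intro card_mono) auto
  then show ?case by simp
next
  case (Cons v vs)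
  let ?C = "container vs"
  let ?C' = "container (v # vs)"
  define w where "w = k - card K"
  define b where "b = D / (4 * real w * real k)"
  have KV: "K \<subseteq> V" using Cons.prems container_subset by blast
  have pos: "0 < real w" "0 < real k"
    using card_sparse_less[OF KV K] by (auto simp: w_def)
  have b: "0 < b" using pos D_pos by (simp add: b_def)
  have KC: "K \<subseteq> ?C" using Cons.prems by (auto simp: step_def)
  have fin: "finite ?C" using container_subset finite_V finite_subset by blast
  have "D * real (card (?C' - K) + w) \<le> 4 * real w * real k * real (deg_in ?C v)"
    unfolding w_def
    by (rule max_degree_ge) (use Cons.prems K container_subset[of "v # vs"] deg_in_step in auto)
  then have "b * real (card (?C' - K) + w) \<le> real (deg_in ?C v)"
    using pos by (simp add: b_def field_simps)
  moreover have "card (?C' - K) + deg_in ?C v \<le> card (?C - K)"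
    using card_step_le[OF fin, of K v] Cons.prems by simp
  then have "real (card (?C' - K)) + real (deg_in ?C v) \<le> real (card (?C - K))"
    by (simp flip: of_nat_add)
  ultimately have "(1 + b) * real (card (?C' - K) + w) \<le> real (card (?C - K) + w)"
    by (simp add: algebra_simps)
  then have "(1 + b) ^ length vs * ((1 + b) * real (card (?C' - K) + w))
      \<le> (1 + b) ^ length vs * real (card (?C - K) + w)"
    using b by (intro mult_left_mono) auto
  also have "\<dots> \<le> real (card V + k)"
    using Cons.IH Cons.prems KC by (simp add: b_def w_def)
  also have "(1 + b) ^ length vs * ((1 + b) * real (card (?C' - K) + w))
      = (1 + b) ^ length (v # vs) * real (card (?C' - K) + w)" by simp
  finally show ?case unfolding b_def w_def .
qed

text \<open>The potential never falls below w = k - |K|, so (1 + b)^t is bounded, and taking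
  logarithms bounds the number t of picks. The \<open>+ 1\<close> counts one further pick: the lemma
  is applied with \<open>K\<close> the container after it.\<close>

lemma card_sparse_in_container_le:
  assumes K: "real (card {e\<in>E. e \<subseteq> K}) \<le> D / 2" and vs: "run vs" "K \<subseteq> container vs"
    and \<Lambda>: "1 \<le> \<Lambda>" "ln (4 * real (card V) * real k / D) \<le> \<Lambda>"
  shows "real (length vs + 1) * D \<le> 16 * real k * \<Lambda> * real (k - card K)"
proof -
  define w where "w = real (k - card K)"
  define b where "b = D / (4 * w * real k)"
  have KV: "K \<subseteq> V" using vs container_subset by blast
  have pos: "0 < w" "0 < real k"
    using card_sparse_less[OF KV K] by (auto simp: w_def)
  have wD: "D \<le> 2 * w * real k" using sparse_deficit_ge[OF KV K] by (simp add: w_def)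
  have b: "0 < b" "b \<le> 1 / 2" using pos D_pos wD by (auto simp: b_def field_simps)
  have n: "0 < real (card V)" using pos k_le by simp
  have "(1 + b) ^ length vs * w
      \<le> (1 + b) ^ length vs * real (card (container vs - K) + (k - card K))"
    using b by (intro mult_left_mono) (auto simp: w_def)
  also have "\<dots> \<le> 2 * real (card V)"
    using container_shrinks[OF K vs] k_le by (simp add: b_def w_def)
  \<comment> \<open>By the deficit bound 2 w k / D \<ge> 1; inserting this factor produces a
    \<open>w\<close> that cancels and leaves a bound independent of \<open>K\<close>.\<close>
  also have "\<dots> \<le> 4 * real (card V) * real k / D * w"
    using mult_left_mono[OF wD, of "2 * real (card V)"] n D_pos by (simp add: field_simps)
  finally have "(1 + b) ^ length vs \<le> 4 * real (card V) * real k / D"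
    using pos(1) by (rule mult_right_le_imp_le)
  then have "ln ((1 + b) ^ length vs) \<le> ln (4 * real (card V) * real k / D)"
    using b by (subst ln_le_cancel_iff) (auto intro: less_le_trans[of _ "(1 + b) ^ length vs"])
  then have "real (length vs) * ln (1 + b) \<le> \<Lambda>"
    using b \<Lambda> by (simp add: ln_realpow)
  moreover have "b / 2 \<le> ln (1 + b)"
  proof -
    have "b\<^sup>2 \<le> b * (1 / 2)" unfolding power2_eq_square using b by (intro mult_left_mono) auto
    then show ?thesis using ln_one_plus_pos_lower_bound[of b] b by linarith
  qed
  then have "real (length vs) * (b / 2) \<le> real (length vs) * ln (1 + b)"
    by (intro mult_left_mono) auto
  ultimately have "real (length vs) * (b / 2) \<le> \<Lambda>" by linarith
  then have 1: "real (length vs) * D \<le> 8 * w * real k * \<Lambda>"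
    using pos by (simp add: b_def field_simps)
  have "2 * w * real k * 1 \<le> 2 * w * real k * \<Lambda>"
    using \<Lambda> pos by (intro mult_left_mono) auto
  then have "D \<le> 2 * w * real k * \<Lambda>" using wD by simp
  moreover have "0 \<le> w * real k * \<Lambda>" using pos \<Lambda> by simp
  ultimately have "real (length vs) * D + D \<le> 16 * (w * real k * \<Lambda>)"
    using 1 by (simp add: algebra_simps)
  then show ?thesis by (simp add: w_def algebra_simps)
qed

text \<open>Take a longest fingerprint inside \<open>I\<close> whose run has not stopped and pick
  once more, with largest degree among the rest of \<open>I\<close>. By maximality the new container
  is sparse, so the size bound applies to it.\<close>

lemma exists_container:
  fixes \<Lambda> \<beta> :: real
  assumes I: "I \<subseteq> V" "\<And>u v. u \<in> I \<Longrightarrow> v \<in> I \<Longrightarrow> {u, v} \<notin> E"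
    and \<Lambda>: "1 \<le> \<Lambda>" "ln (4 * real (card V) * real k / D) \<le> \<Lambda>"
    and \<beta>: "\<beta> = D / (16 * (real k)\<^sup>2 * \<Lambda>)"
    and large: "1 \<le> \<beta> * real (card I)"
  shows "\<exists>vs. vs \<noteq> [] \<and> distinct vs \<and> set vs \<subseteq> I \<and> I - set vs \<subseteq> container vs
           \<and> real (card (container vs)) \<le> (1 - real (length vs) * \<beta>) * real k"
proof -
  have fI: "finite I" using I finite_V finite_subset by blast
  have k: "0 < real k" using large \<beta> by (cases "k = 0") auto
  have sizes: "real (card K) \<le> (1 - real (length vs + 1) * \<beta>) * real k"
    if "real (card {e\<in>E. e \<subseteq> K}) \<le> D / 2" "run vs" "K \<subseteq> container vs" for K vs
  proof -
    have "card K < k" using card_sparse_less[of K] that container_subset by blast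
    moreover have "real (length vs + 1) * D \<le> 16 * real k * \<Lambda> * real (k - card K)"
      by (rule card_sparse_in_container_le[OF that \<Lambda>])
    moreover have "0 < 16 * real k * \<Lambda>" using \<Lambda> k by simp
    ultimately have "real (length vs + 1) * D / (16 * real k * \<Lambda>) \<le> real k - real (card K)"
      by (simp add: pos_divide_le_eq mult.commute of_nat_diff)
    moreover have "real (length vs + 1) * D / (16 * real k * \<Lambda>) = real (length vs + 1) * \<beta> * real k"
      using k by (simp add: \<beta> power2_eq_square)
    ultimately show ?thesis by (simp add: algebra_simps)
  qed
  define P where "P = (\<lambda>vs. distinct vs \<and> set vs \<subseteq> I \<and> I - set vs \<subseteq> container vs \<and> run vs)"
  have "P []" using I by (auto simp: P_def)
  moreover have "\<forall>vs. P vs \<longrightarrow> length vs < Suc (card I)"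
    using fI by (auto simp: P_def less_Suc_eq_le distinct_card[symmetric] intro!: card_mono)
  ultimately obtain vs where vs: "P vs" and mx: "\<And>us. P us \<Longrightarrow> length us \<le> length vs"
    using ex_has_greatest_nat[of P "[]" length "Suc (card I)"] by auto
  \<comment> \<open>If all of \<open>I\<close> had been picked, \<open>sizes\<close> with the empty
    set as \<open>K\<close> would give (|I| + 1) \<beta> \<le> 1, against 1 \<le> \<beta>
    |I|.\<close>
  have rest: "I - set vs \<noteq> {}"
  proof
    assume "I - set vs = {}"
    then have "I = set vs" using vs by (auto simp: P_def)
    then have "card I = length vs" using vs by (simp add: P_def distinct_card)
    moreover have "e \<noteq> {}" if "e \<in> E" for e using edge[OF that] by auto
    then have "{e\<in>E. e \<subseteq> {}} = {}" by auto
    then have "real (card {e\<in>E. e \<subseteq> {}}) \<le> D / 2" using D_pos by (simp only: card.empty)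
    then have "0 \<le> (1 - real (length vs + 1) * \<beta>) * real k"
      using sizes[of "{}" vs] vs by (simp add: P_def)
    then have "real (length vs + 1) * \<beta> \<le> 1" using k by (simp add: zero_le_mult_iff)
    moreover have "0 < \<beta>" using \<beta> k \<Lambda> D_pos by simp
    ultimately show False using large by (simp add: algebra_simps)
  qed
  obtain v where v: "v \<in> I - set vs"
    and "deg_in (container vs) v = Max (deg_in (container vs) ` (I - set vs))"
    using obtains_MAX[OF finite_Diff[OF fI] rest] by metis
  then have vmax: "deg_in (container vs) u \<le> deg_in (container vs) v" if "u \<in> I - set vs" for u
    using fI that by simp
  \<comment> \<open>Neighbours of \<open>v\<close> are outside \<open>I\<close> by independence, and
    remaining vertices of larger degree by the choice of \<open>v\<close>.\<close>
  have cover: "I - set (v # vs) \<subseteq> container (v # vs)"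
    using vs v vmax I(2) by (auto simp: P_def step_def)
  have sparse: "real (card {e\<in>E. e \<subseteq> container (v # vs)}) \<le> D / 2"
  proof (rule ccontr)
    assume "\<not> ?thesis"
    then have "P (v # vs)" using vs v cover by (auto simp: P_def)
    then show False using mx[of "v # vs"] by simp
  qed
  have "real (card (container (v # vs))) \<le> (1 - real (length vs + 1) * \<beta>) * real k"
    using sizes[OF sparse, of vs] vs by (auto simp: P_def step_def)
  then show ?thesis using vs v cover by (intro exI[of _ "v # vs"]) (auto simp: P_def)
qed

end

section \<open>Large independent sets in the sample\<close>

text \<open>As \<beta>^2 \<mu> \<ge> 64, the losses 2 sqrt \<mu> and t together are at most half of
  the gap t \<beta> \<mu>. The exponent is then at most - z t \<beta> \<mu> / 2 + z^2 \<mu>, which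
  is minimal at z = t \<beta> / 4.\<close>

lemma tail_exponent_le:
  fixes \<beta> \<mu> z x t :: real
  assumes t: "1 \<le> t" "t * \<beta> \<le> 1" and \<beta>: "0 < \<beta>" and \<mu>: "0 \<le> \<mu>" "64 \<le> \<beta>\<^sup>2 * \<mu>"
    and z: "z = t * \<beta> / 4" and x: "x \<le> (1 - t * \<beta>) * \<mu>"
  shows "z * x - (\<mu> - 2 * sqrt \<mu> - t) * ln (1 + z) \<le> - (t * (\<beta>\<^sup>2 * \<mu> / 16))"
proof -
  define q where "q = sqrt \<mu>"
  have q: "q * q = \<mu>" "0 \<le> q" using \<mu> by (auto simp: q_def)
  have "8\<^sup>2 \<le> (\<beta> * q)\<^sup>2" using \<mu>(2) q by (simp add: power2_eq_square mult_ac)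
  then have \<beta>q: "8 \<le> \<beta> * q" by (rule power2_le_imp_le) (use \<beta> q in auto)
  have \<beta>1: "\<beta> \<le> 1" using t \<beta> mult_right_mono[of 1 t \<beta>] by linarith
  have q8: "8 \<le> q" using \<beta>q mult_right_mono[OF \<beta>1 q(2)] by simp
  have "t * 8 \<le> t * (\<beta> * q)" using \<beta>q t by (intro mult_left_mono) auto
  also have "\<dots> = (t * \<beta>) * q" by simp
  also have "\<dots> \<le> 1 * q" using t q by (intro mult_right_mono) auto
  finally have tq: "8 * t \<le> q" by simp
  have "8 * q \<le> q * q" using q8 by (intro mult_right_mono) auto
  then have \<mu>q: "8 * q \<le> \<mu>" using q by simp
  have "0 \<le> t * \<beta>" using t \<beta> by simp
  then have z0: "0 \<le> z" "z \<le> 1" using z t by auto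
  \<comment> \<open>Nonnegativity of this factor allows ln (1 + z) to be replaced by the smaller z -
    z^2.\<close>
  have M: "0 \<le> \<mu> - 2 * q - t" using tq \<mu>q t by linarith
  have "(\<mu> - 2 * q - t) * (z - z\<^sup>2) \<le> (\<mu> - 2 * q - t) * ln (1 + z)"
    using M ln_one_plus_pos_lower_bound[of z] z0 by (intro mult_left_mono) auto
  moreover have "z * x \<le> z * ((1 - t * \<beta>) * \<mu>)" using x z0 by (intro mult_left_mono) auto
  ultimately have "z * x - (\<mu> - 2 * q - t) * ln (1 + z)
      \<le> z * ((1 - t * \<beta>) * \<mu>) - (\<mu> - 2 * q - t) * (z - z\<^sup>2)" by linarith
  also have "\<dots> = z * (2 * q + t - t * \<beta> * \<mu>) + z\<^sup>2 * (\<mu> - 2 * q - t)"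
    by (simp add: algebra_simps)
  also have "\<dots> \<le> z * (- (t * \<beta> * \<mu> / 2)) + z\<^sup>2 * \<mu>"
  proof (intro add_mono mult_left_mono)
    have "8 * q \<le> \<beta> * q * q" using \<beta>q q by (intro mult_right_mono) auto
    then have a: "8 * q \<le> \<beta> * \<mu>" using q by (simp add: mult.assoc)
    have "1 * (\<beta> * \<mu>) \<le> t * (\<beta> * \<mu>)" using t \<beta> \<mu> by (intro mult_right_mono) auto
    then have b: "8 * q \<le> t * \<beta> * \<mu>" using a by simp
    have "t * 64 \<le> t * (\<beta> * \<mu>)" using a q8 t by (intro mult_left_mono) auto
    then show "2 * q + t - t * \<beta> * \<mu> \<le> - (t * \<beta> * \<mu> / 2)"
      using b t unfolding mult.assoc[of t] by linarith
    show "\<mu> - 2 * q - t \<le> \<mu>" using q t by simp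
  qed (use z0 in auto)
  also have "\<dots> = - (t * t * (\<beta>\<^sup>2 * \<mu> / 16))"
    by (simp add: z power2_eq_square field_simps)
  also have "\<dots> \<le> - (1 * t * (\<beta>\<^sup>2 * \<mu> / 16))"
    using t \<mu> by (intro le_imp_neg_le mult_right_mono) auto
  finally show ?thesis by (simp add: q_def)
qed

lemma sum_power_quarter_le: "(\<Sum>t=1..n. (1 / 4 :: real) ^ t) \<le> 1 / 3"
proof -
  have "(\<Sum>t=1..n. (1 / 4 :: real) ^ t) = (1 - (1 / 4) ^ n) / 3"
  proof (induction n)
    case (Suc n)
    have "(\<Sum>t=1..Suc n. (1 / 4 :: real) ^ t) = (\<Sum>t=1..n. (1 / 4) ^ t) + (1 / 4) ^ n / 4" by simp
    then show ?case unfolding Suc by simp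
  qed simp
  then show ?thesis by simp
qed

text \<open>Union bound over fingerprints. There are at most \<open>n ^ t\<close> lists of length t,
  each contained in a sample with probability at most (s / n)^t; the tail factor exp (- t (ln s +
  4)) beats the resulting s^t and leaves a geometric series in exp (- 4).\<close>

lemma (in locally_dense_graph) card_samples_with_independent_set_le:
  fixes \<Lambda> \<beta> \<mu> :: real
  assumes s: "1 \<le> s" "s \<le> card V"
    and \<Lambda>: "1 \<le> \<Lambda>" "ln (4 * real (card V) * real k / D) \<le> \<Lambda>"
    and \<beta>: "\<beta> = D / (16 * (real k)\<^sup>2 * \<Lambda>)"
    and \<mu>: "\<mu> = real k * real s / real (card V)"
    and large: "16 * ln (real s) + 64 \<le> \<beta>\<^sup>2 * \<mu>"
  shows "real (card {S. S \<subseteq> V \<and> card S = s \<and>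
             (\<exists>I\<subseteq>S. (\<forall>u\<in>I. \<forall>v\<in>I. {u, v} \<notin> E) \<and> \<mu> - 2 * sqrt \<mu> \<le> real (card I))})
       \<le> real (card V choose s) / 3"
proof -
  define n where "n = card V"
  define N where "N = real (n choose s)"
  define M where "M = \<mu> - 2 * sqrt \<mu>"
  have n: "1 \<le> n" using s by (simp add: n_def)
  have V: "V \<noteq> {}" using n by (auto simp: n_def)
  have \<mu>0: "0 \<le> \<mu>" by (simp add: \<mu>)
  have "0 \<le> ln (real s)" using s by simp
  then have b64: "64 \<le> \<beta>\<^sup>2 * \<mu>" using large by linarith
  then have k: "0 < real k" using \<beta> by (cases "k = 0") auto
  have \<beta>0: "0 < \<beta>" using \<beta> k \<Lambda> D_pos by simp
  have "{e\<in>E. e \<subseteq> {}} = {}"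
  proof -
    have "e \<noteq> {}" if "e \<in> E" for e using edge[OF that] by auto
    then show ?thesis by auto
  qed
  then have sparse: "real (card {e\<in>E. e \<subseteq> {}}) \<le> D / 2" using D_pos by (simp only: card.empty)
  \<comment> \<open>The size bound for the empty fingerprint and the empty set as \<open>K\<close>
    reads D \<le> 16 k^2 \<Lambda>.\<close>
  have "\<beta> * 1 \<le> 1"
    using card_sparse_in_container_le[OF sparse _ _ \<Lambda>, of "[]"] k \<Lambda>
    by (simp add: \<beta> power2_eq_square field_simps)
  then have \<beta>1: "\<beta> \<le> 1" by simp
  \<comment> \<open>This supplies the hypothesis \<open>large\<close> of
    \<open>exists_container\<close> for any independent set of size at least
    \<open>M\<close>.\<close>
  have MB: "1 \<le> \<beta> * M"
  proof -
    define q where "q = sqrt \<mu>"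
    have q: "q * q = \<mu>" "0 \<le> q" using \<mu>0 by (auto simp: q_def)
    have "8\<^sup>2 \<le> (\<beta> * q)\<^sup>2" using b64 q by (simp add: power2_eq_square mult_ac)
    then have \<beta>q: "8 \<le> \<beta> * q" by (rule power2_le_imp_le) (use \<beta>0 q in auto)
    then have q8: "8 \<le> q" using mult_right_mono[OF \<beta>1 q(2)] by simp
    have "8 * 6 \<le> (\<beta> * q) * (q - 2)" using \<beta>q q8 by (intro mult_mono) auto
    then show ?thesis using q by (simp add: M_def q_def[symmetric] algebra_simps)
  qed
  define Ls where "Ls = (\<lambda>t. {vs. set vs \<subseteq> V \<and> length vs = t \<and> distinct vs
      \<and> real (card (container vs)) \<le> (1 - real t * \<beta>) * real k})"
  \<comment> \<open>The container must receive the rest of the independent set, at least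
    \<open>M\<close> minus the length of the fingerprint.\<close>
  define T where "T = (\<lambda>vs. {S. S \<subseteq> V \<and> card S = s \<and> set vs \<subseteq> S
      \<and> M - real (length vs) \<le> real (card (S \<inter> container vs))})"
  let ?B = "{S. S \<subseteq> V \<and> card S = s \<and>
             (\<exists>I\<subseteq>S. (\<forall>u\<in>I. \<forall>v\<in>I. {u, v} \<notin> E) \<and> \<mu> - 2 * sqrt \<mu> \<le> real (card I))}"
  have fLs: "finite (Ls t)" for t
    unfolding Ls_def using finite_lists_length_eq[OF finite_V, of t] by (rule rev_finite_subset) auto
  have cLs: "card (Ls t) \<le> n ^ t" for t
  proof -
    have "card (Ls t) \<le> card {vs. set vs \<subseteq> V \<and> length vs = t}"
      unfolding Ls_def using finite_lists_length_eq[OF finite_V, of t] by (intro card_mono) auto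
    then show ?thesis by (simp add: card_lists_length_eq[OF finite_V] n_def)
  qed
  have fT: "finite (T vs)" for vs unfolding T_def using finite_V by simp
  have "?B \<subseteq> (\<Union>t\<in>{1..n}. \<Union>vs\<in>Ls t. T vs)"
  proof
    fix S assume "S \<in> ?B"
    then obtain I where S: "S \<subseteq> V" "card S = s" and I: "I \<subseteq> S"
      "\<And>u v. u \<in> I \<Longrightarrow> v \<in> I \<Longrightarrow> {u, v} \<notin> E" "M \<le> real (card I)"
      by (auto simp: M_def)
    have fS: "finite S" using S(1) finite_V by (rule finite_subset)
    have "\<beta> * M \<le> \<beta> * real (card I)" using I \<beta>0 by (intro mult_left_mono) auto
    then have "1 \<le> \<beta> * real (card I)" using MB by linarith
    then obtain vs where vs: "vs \<noteq> []" "distinct vs" "set vs \<subseteq> I" "I - set vs \<subseteq> container vs"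
      "real (card (container vs)) \<le> (1 - real (length vs) * \<beta>) * real k"
      using exists_container[of I \<Lambda> \<beta>] I S \<Lambda> \<beta> by blast
    have "length vs \<le> n"
      using vs(2,3) I(1) S(1) finite_V card_mono[of V "set vs"] by (simp add: n_def distinct_card)
    moreover have "1 \<le> length vs" using vs(1) by (cases vs) auto
    moreover have "vs \<in> Ls (length vs)" using vs I S by (auto simp: Ls_def)
    moreover have "S \<in> T vs"
    proof -
      have "card I - card (set vs) = card (I - set vs)"
        using vs(3) by (simp add: card_Diff_subset)
      also have "\<dots> \<le> card (S \<inter> container vs)"
        using vs(4) I(1) fS by (intro card_mono) auto
      finally have "real (card I) - real (length vs) \<le> real (card (S \<inter> container vs))"
        using vs(2) by (simp add: distinct_card)
      then show ?thesis using S I vs(3) by (auto simp: T_def)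
    qed
    ultimately show "S \<in> (\<Union>t\<in>{1..n}. \<Union>vs\<in>Ls t. T vs)" by auto
  qed
  then have "card ?B \<le> card (\<Union>t\<in>{1..n}. \<Union>vs\<in>Ls t. T vs)"
    using fLs fT by (intro card_mono) auto
  also have "\<dots> \<le> (\<Sum>t=1..n. card (\<Union>vs\<in>Ls t. T vs))"
    by (rule card_UN_le) simp
  also have "\<dots> \<le> (\<Sum>t=1..n. \<Sum>vs\<in>Ls t. card (T vs))"
    using fLs by (intro sum_mono card_UN_le)
  finally have "real (card ?B) \<le> (\<Sum>t=1..n. \<Sum>vs\<in>Ls t. real (card (T vs)))"
    by (simp flip: of_nat_sum)
  also have "\<dots> \<le> (\<Sum>t=1..n. \<Sum>vs\<in>Ls t. N * (exp (- 4) / real n) ^ t)"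
  proof (intro sum_mono)
    fix t vs assume t: "t \<in> {1..n}" and vs: "vs \<in> Ls t"
    define z where "z = real t * \<beta> / 4"
    have vs': "set vs \<subseteq> V" "length vs = t" "card (set vs) = t"
      "real (card (container vs)) \<le> (1 - real t * \<beta>) * real k"
      using vs by (auto simp: Ls_def distinct_card)
    have t1: "1 \<le> real t" using t by simp
    have "0 \<le> (1 - real t * \<beta>) * real k" using vs'(4) by (rule order_trans[rotated]) simp
    \<comment> \<open>Container sizes are nonnegative, so fingerprints with t \<beta> > 1 do not
      occur in \<open>Ls\<close>.\<close>
    then have t\<beta>: "real t * \<beta> \<le> 1" using k by (simp add: zero_le_mult_iff)
    have x: "real s / real n * real (card (container vs)) \<le> (1 - real t * \<beta>) * \<mu>"
      using mult_left_mono[OF vs'(4), of "real s / real n"] by (simp add: \<mu> n_def mult_ac)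
    have "real (card (T vs)) \<le> N * (real s / real n) ^ t
        * exp (z * (real s / real n) * real (card (container vs)) - (M - real t) * ln (1 + z))"
      using card_upper_tail_le[OF finite_V V s(2) vs'(1) container_subset container_disjoint,
          of z "M - real t"] vs' \<beta>0 by (simp add: T_def N_def n_def z_def)
    also have "\<dots> \<le> N * (real s / real n) ^ t * exp (- (real t * (ln (real s) + 4)))"
    proof (intro mult_left_mono)
      have "z * (real s / real n * real (card (container vs))) - (M - real t) * ln (1 + z)
          \<le> - (real t * (\<beta>\<^sup>2 * \<mu> / 16))"
        unfolding M_def by (rule tail_exponent_le[OF t1 t\<beta> \<beta>0 \<mu>0 b64 z_def x])
      moreover have "real t * (ln (real s) + 4) \<le> real t * (\<beta>\<^sup>2 * \<mu> / 16)"
        using large t1 by (intro mult_left_mono) auto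
      ultimately show "exp (z * (real s / real n) * real (card (container vs))
            - (M - real t) * ln (1 + z)) \<le> exp (- (real t * (ln (real s) + 4)))"
        unfolding exp_le_cancel_iff mult.assoc[of z] by linarith
    qed (auto simp: N_def)
    also have "exp (- (real t * (ln (real s) + 4))) = (exp (- 4) / real s) ^ t"
    proof -
      have "exp (- (real t * (ln (real s) + 4))) = exp (real t * (- 4 - ln (real s)))"
        by (simp add: algebra_simps)
      also have "\<dots> = exp (- 4 - ln (real s)) ^ t" by (rule exp_of_nat_mult)
      finally show ?thesis using s by (simp add: exp_diff)
    qed
    also have "N * (real s / real n) ^ t * (exp (- 4) / real s) ^ t = N * (exp (- 4) / real n) ^ t"
      using s by (simp add: power_mult_distrib[symmetric] mult.assoc)
    finally show "real (card (T vs)) \<le> N * (exp (- 4) / real n) ^ t" .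
  qed
  also have "\<dots> = (\<Sum>t=1..n. real (card (Ls t)) * (N * (exp (- 4) / real n) ^ t))" by simp
  also have "\<dots> \<le> (\<Sum>t=1..n. real (n ^ t) * (N * (exp (- 4) / real n) ^ t))"
    using cLs by (intro sum_mono mult_right_mono) (auto simp: N_def simp del: of_nat_power)
  also have "\<dots> = N * (\<Sum>t=1..n. exp (- 4) ^ t)"
    using n by (simp add: sum_distrib_left power_divide mult_ac)
  also have "\<dots> \<le> N * (\<Sum>t=1..n. (1 / 4) ^ t)"
  proof (intro mult_left_mono sum_mono power_mono)
    have "(4::real) \<le> exp 4" using exp_ge_add_one_self[of 4] by simp
    then show "exp (- 4) \<le> (1 / 4 :: real)" by (simp add: exp_minus field_simps)
  qed (auto simp: N_def)
  also have "\<dots> \<le> N * (1 / 3)"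
    by (intro mult_left_mono sum_power_quarter_le) (simp add: N_def)
  finally show ?thesis by (simp add: N_def n_def)
qed

section \<open>The tester\<close>

text \<open>A set of \<open>k\<close> vertices has only k (k - 1) / 2 pairs. In the theorem this
  yields k \<ge> 2 and \<epsilon> n^2 \<le> k^2 / 2 whenever a far graph exists.\<close>

lemma (in locally_dense_graph) D_le: "D \<le> real k * (real k - 1) / 2"
proof -
  obtain U where U: "U \<subseteq> V" "card U = k" "finite U"
    using obtain_subset_with_card_n[OF k_le] by metis
  have "card {e\<in>E. e \<subseteq> U} \<le> card {e. e \<subseteq> U \<and> card e = 2}"
    using U(3) edge by (intro card_mono) auto
  also have "\<dots> = k choose 2" using n_subsets[OF U(3), of 2] U(2) by simp
  finally have "D \<le> real (k choose 2)" using dense[of U] U by simp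
  also have "real (k choose 2) \<le> real k * (real k - 1) / 2"
  proof (cases k)
    case (Suc m)
    have "2 * (k choose 2) \<le> k * (k - 1)" by (simp add: choose_two)
    then have "real (2 * (k choose 2)) \<le> real (k * (k - 1))" by (simp only: of_nat_le_iff)
    then show ?thesis using Suc by (simp add: algebra_simps)
  qed simp
  finally show ?thesis .
qed

text \<open>The factor L^3 in the sample size, L = ln (1 / \<epsilon>), pays L^2 for the squared
  logarithm in \<beta>^2 and leaves one L to dominate ln s.\<close>

lemma sample_size_sufficient:
  fixes \<rho> \<epsilon> :: real and n k s :: nat
  assumes \<rho>: "0 < \<rho>" "\<rho> \<le> 1" and \<epsilon>: "0 < \<epsilon>"
    and k: "k = nat \<lceil>\<rho> * real n\<rceil>" "2 \<le> k" "k \<le> n" and D: "\<epsilon> * (real n)\<^sup>2 \<le> (real k)\<^sup>2 / 2"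
    and s: "s = nat \<lfloor>2 ^ 27 * (\<rho> ^ 3 / \<epsilon>\<^sup>2) * ln (1 / \<epsilon>) ^ 3\<rfloor>"
  shows "\<epsilon> \<le> 1 / 2" "1 \<le> s" "real s \<le> 2 ^ 27 * (\<rho> ^ 3 / \<epsilon>\<^sup>2) * ln (1 / \<epsilon>) ^ 3"
    "1 \<le> ln (4 / \<epsilon>)" "ln (4 * real n * real k / (\<epsilon> * (real n)\<^sup>2)) \<le> ln (4 / \<epsilon>)"
    "16 * ln (real s) + 64
       \<le> (\<epsilon> * (real n)\<^sup>2 / (16 * (real k)\<^sup>2 * ln (4 / \<epsilon>)))\<^sup>2 * (real k * real s / real n)"
proof -
  define L where "L = ln (1 / \<epsilon>)"
  define \<Lambda> where "\<Lambda> = ln (4 / \<epsilon>)"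
  define R where "R = 2 ^ 27 * (\<rho> ^ 3 / \<epsilon>\<^sup>2) * L ^ 3"
  have kn: "0 < real k" "0 < real n" "real k \<le> real n" using k(2,3) by auto
  have "(real k)\<^sup>2 \<le> (real n)\<^sup>2" using kn by (intro power_mono) auto
  then have "\<epsilon> * (real n)\<^sup>2 \<le> 1 / 2 * (real n)\<^sup>2" using D by linarith
  then show \<epsilon>2: "\<epsilon> \<le> 1 / 2" by (rule mult_right_le_imp_le) (use kn in simp)
  have "ln 2 \<le> L" unfolding L_def using \<epsilon> \<epsilon>2 by (subst ln_le_cancel_iff) (auto simp: field_simps)
  then have L: "2 / 3 \<le> L" using ln2_ge_two_thirds by linarith
  have ln4: "ln 4 = 2 * ln (2::real)"
    using ln_realpow[of "2::real" 2] by simp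
  have \<Lambda>_eq: "\<Lambda> = 2 * ln 2 + L"
    using ln_mult[of 4 "1 / \<epsilon>"] \<epsilon> by (simp add: \<Lambda>_def L_def ln4)
  have \<Lambda>3: "\<Lambda> \<le> 3 * L" using \<Lambda>_eq \<open>ln 2 \<le> L\<close> by simp
  show \<Lambda>1: "1 \<le> ln (4 / \<epsilon>)" using \<Lambda>_eq L ln2_ge_two_thirds unfolding \<Lambda>_def by linarith
  have "4 * real n * real k / (\<epsilon> * (real n)\<^sup>2) \<le> 4 / \<epsilon>"
    using kn \<epsilon> by (simp add: field_simps power2_eq_square)
  then show "ln (4 * real n * real k / (\<epsilon> * (real n)\<^sup>2)) \<le> ln (4 / \<epsilon>)"
    using kn \<epsilon> by (subst ln_le_cancel_iff) auto
  \<comment> \<open>From k < \<rho> n + 1 and k \<ge> 2 follows \<rho> n > 1, so rounding up costs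
    at most a factor 2.\<close>
  have kr: "real k \<le> 2 * \<rho> * real n"
  proof -
    have a: "0 \<le> \<rho> * real n" using \<rho> by simp
    have "real k < \<rho> * real n + 1" using a unfolding k(1) by linarith
    moreover have "2 \<le> real k" using k by simp
    ultimately show ?thesis by linarith
  qed
  have "(real k)\<^sup>2 \<le> (2 * \<rho> * real n)\<^sup>2" using kr kn by (intro power_mono) auto
  then have "\<epsilon> * (real n)\<^sup>2 \<le> 2 * \<rho>\<^sup>2 * (real n)\<^sup>2" using D by (simp add: power_mult_distrib)
  \<comment> \<open>This bounds \<rho>^3 / \<epsilon>^2 below by 1/4, so R \<ge> 2 and rounding down
    loses at most half of \<open>R\<close>.\<close>
  then have \<epsilon>\<rho>: "\<epsilon> \<le> 2 * \<rho>\<^sup>2" by (rule mult_right_le_imp_le) (use kn in simp)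
  have "\<epsilon>\<^sup>2 \<le> (2 * \<rho>\<^sup>2)\<^sup>2" using \<epsilon>\<rho> \<epsilon> by (intro power_mono) auto
  also have "\<dots> = 4 * \<rho> ^ 3 * \<rho>" by (simp add: power2_eq_square power3_eq_cube)
  also have "\<dots> \<le> 4 * \<rho> ^ 3 * 1" using \<rho> by (intro mult_left_mono) auto
  finally have r4: "1 / 4 \<le> \<rho> ^ 3 / \<epsilon>\<^sup>2" using \<epsilon> by (simp add: field_simps)
  have "(2 / 3) ^ 3 \<le> L ^ 3" using L by (intro power_mono) auto
  then have "1 / 4 \<le> L ^ 3" by (simp add: power3_eq_cube)
  then have "1 / 4 * (1 / 4) \<le> \<rho> ^ 3 / \<epsilon>\<^sup>2 * L ^ 3" using r4 \<rho> by (intro mult_mono) auto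
  then have R2: "2 \<le> R" by (simp add: R_def)
  have sR: "s = nat \<lfloor>R\<rfloor>" by (simp add: s R_def L_def)
  have sR1: "real s \<le> R" "R / 2 \<le> real s" using R2 unfolding sR by linarith+
  show "real s \<le> 2 ^ 27 * (\<rho> ^ 3 / \<epsilon>\<^sup>2) * ln (1 / \<epsilon>) ^ 3"
    using sR1(1) by (simp add: R_def L_def)
  show s1: "1 \<le> s" using R2 unfolding sR by linarith
  have lnR: "ln (real s) \<le> 27 + 5 * L"
  proof -
    have "ln (real s) \<le> ln R" using s1 sR1 by (subst ln_le_cancel_iff) auto
    also have "R = 2 ^ 27 * (\<rho> ^ 3 * ((1 / \<epsilon>) ^ 2 * L ^ 3))"
      by (simp add: R_def power_divide)
    also have "ln \<dots> = ln (2 ^ 27) + (ln (\<rho> ^ 3) + (ln ((1 / \<epsilon>) ^ 2) + ln (L ^ 3)))"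
      using \<rho> \<epsilon> L by (subst ln_mult; simp add: ln_mult)+
    also have "\<dots> = 27 * ln 2 + (3 * ln \<rho> + (2 * L + 3 * ln L))"
      using \<rho> \<epsilon> L ln_realpow[of "2::real" 27] ln_realpow[of "1 / \<epsilon>" 2]
      by (simp add: ln_realpow L_def[symmetric])
    also have "\<dots> \<le> 27 * 1 + (3 * 0 + (2 * L + 3 * L))"
    proof -
      have "ln (2::real) \<le> 1" using ln_le_minus_one[of "2::real"] by simp
      moreover have "ln \<rho> \<le> 0" using \<rho> by simp
      moreover have "ln L \<le> L" using ln_le_minus_one[of L] L by simp
      ultimately show ?thesis by linarith
    qed
    finally show ?thesis by simp
  qed
  have "16 * ln (real s) + 64 \<le> 2 ^ 27 / 36864 * L" using lnR L by simp
  also have "\<dots> = \<epsilon>\<^sup>2 * R / (36864 * \<rho> ^ 3 * L\<^sup>2)"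
    using \<epsilon> \<rho> L by (simp add: R_def power2_eq_square power3_eq_cube)
  also have "\<dots> \<le> \<epsilon>\<^sup>2 * (2 * real s) / (36864 * \<rho> ^ 3 * L\<^sup>2)"
    using sR1 \<epsilon> \<rho> by (intro divide_right_mono mult_left_mono) auto
  also have "\<dots> = \<epsilon>\<^sup>2 * real s * (real n) ^ 3 / (256 * (2 * \<rho> * real n) ^ 3 * (3 * L)\<^sup>2)"
    using kn by (simp add: power_mult_distrib mult_ac)
  also have "\<dots> \<le> \<epsilon>\<^sup>2 * real s * (real n) ^ 3 / (256 * (real k) ^ 3 * \<Lambda>\<^sup>2)"
  proof (rule divide_left_mono)
    have "0 < \<Lambda>" using \<Lambda>1 by (simp add: \<Lambda>_def)
    then show "256 * (real k) ^ 3 * \<Lambda>\<^sup>2 \<le> 256 * (2 * \<rho> * real n) ^ 3 * (3 * L)\<^sup>2"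
      using kr kn \<Lambda>3 \<rho> by (intro mult_mono power_mono) auto
    show "0 < 256 * (2 * \<rho> * real n) ^ 3 * (3 * L)\<^sup>2 * (256 * (real k) ^ 3 * \<Lambda>\<^sup>2)"
      using kn \<rho> L \<open>0 < \<Lambda>\<close> by simp
  qed simp
  also have "\<dots> = (\<epsilon> * (real n)\<^sup>2 / (16 * (real k)\<^sup>2 * \<Lambda>))\<^sup>2 * (real k * real s / real n)"
    using kn \<Lambda>1 by (simp add: \<Lambda>_def[symmetric] power2_eq_square power3_eq_cube field_simps)
  finally show "16 * ln (real s) + 64
       \<le> (\<epsilon> * (real n)\<^sup>2 / (16 * (real k)\<^sup>2 * ln (4 / \<epsilon>)))\<^sup>2 * (real k * real s / real n)"
    by (simp add: \<Lambda>_def)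
qed

lemma eps_far_locally_dense:
  assumes G: "G \<in> graphs_on n" and far: "eps_far \<epsilon> (indep_set_property \<rho>) G"
    and pos: "1 \<le> n" "0 < \<epsilon>" "\<rho> \<le> 1"
  shows "locally_dense_graph {..<n} (edges G) (nat \<lceil>\<rho> * real n\<rceil>) (\<epsilon> * (real n)\<^sup>2)"
proof
  let ?k = "nat \<lceil>\<rho> * real n\<rceil>"
  have V: "verts G = {..<n}" and sg: "simple_graph G" using G by (auto simp: graphs_on_def)
  show "e \<subseteq> {..<n} \<and> card e = 2" if "e \<in> edges G" for e
    using sg that V by (auto simp: simple_graph_def)
  have "\<rho> * real n \<le> 1 * real n" using pos by (intro mult_right_mono) auto
  then show "?k \<le> card {..<n}" by (simp add: ceiling_le_iff nat_le_iff)
  show "0 < \<epsilon> * (real n)\<^sup>2" using pos by simp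
  fix U assume U: "U \<subseteq> {..<n}" "?k \<le> card U"
  then obtain U' where U': "U' \<subseteq> U" "card U' = ?k" "finite U'"
    using obtain_subset_with_card_n by metis
  define H where "H = ({..<n}, edges G - {e. e \<subseteq> U'})"
  have "independent_set H U'"
    using U U' by (auto simp: independent_set_def H_def)
  moreover have "simple_graph H"
    using sg V by (auto simp: simple_graph_def H_def)
  ultimately have "H \<in> indep_set_property \<rho>"
    using U' by (auto simp: indep_set_property_def H_def)
  then have "\<epsilon> * (real n)\<^sup>2 \<le> real (card (sym_diff (edges G) (edges H)))"
    using far V by (auto simp: eps_far_def H_def)
  also have "sym_diff (edges G) (edges H) = {e\<in>edges G. e \<subseteq> U'}"
    by (auto simp: H_def)
  also have "card {e\<in>edges G. e \<subseteq> U'} \<le> card {e\<in>edges G. e \<subseteq> U}"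
  proof (rule card_mono)
    have "edges G \<subseteq> Pow (verts G)" using sg by (auto simp: simple_graph_def)
    then have "finite (edges G)" using V by (auto intro: finite_subset)
    then show "finite {e\<in>edges G. e \<subseteq> U}" by simp
  qed (use U' in auto)
  finally show "\<epsilon> * (real n)\<^sup>2 \<le> real (card {e\<in>edges G. e \<subseteq> U})" by simp
qed simp

lemma accept_prob_deterministic:
  assumes "s \<le> n"
  shows "accept_prob n s (\<lambda>H. return_pmf (Q H)) G
    = real (card {S. S \<subseteq> {..<n} \<and> card S = s \<and> Q (induced_subgraph G S)}) / real (n choose s)"
proof -
  let ?SS = "{S. S \<subseteq> {..<n} \<and> card S = s}"
  have card: "card ?SS = n choose s" using n_subsets[of "{..<n}" s] by simp
  have "0 < card ?SS" using assms by (simp add: card)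
  then have ne: "?SS \<noteq> {}" "finite ?SS" by (auto simp: card_gt_0_iff)
  have "accept_prob n s (\<lambda>H. return_pmf (Q H)) G
      = pmf (map_pmf (\<lambda>S. Q (induced_subgraph G S)) (pmf_of_set ?SS)) True"
    by (simp add: accept_prob_def map_pmf_def)
  also have "\<dots> = real (card (?SS \<inter> (\<lambda>S. Q (induced_subgraph G S)) -` {True})) / real (card ?SS)"
    using ne by (simp add: pmf_map measure_pmf_of_set)
  also have "?SS \<inter> (\<lambda>S. Q (induced_subgraph G S)) -` {True}
      = {S. S \<subseteq> {..<n} \<and> card S = s \<and> Q (induced_subgraph G S)}" by auto
  finally show ?thesis by (simp add: card)
qed

lemma sample_complexity_le:
  assumes "canonical_tester \<delta>\<^sub>1 \<delta>\<^sub>2 P n \<epsilon> s A" "real s \<le> r"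
  shows "ereal_of_enat (sample_complexity \<delta>\<^sub>1 \<delta>\<^sub>2 P n \<epsilon>) \<le> ereal r"
proof -
  have "sample_complexity \<delta>\<^sub>1 \<delta>\<^sub>2 P n \<epsilon> \<le> enat s"
    unfolding sample_complexity_def using assms(1) by (intro Inf_lower) auto
  then have "ereal_of_enat (sample_complexity \<delta>\<^sub>1 \<delta>\<^sub>2 P n \<epsilon>) \<le> ereal_of_enat (enat s)"
    by (simp only: ereal_of_enat_le_iff)
  also have "\<dots> \<le> ereal r" using assms(2) by simp
  finally show ?thesis .
qed

lemma canonical_tester_trivial:
  assumes "\<And>G. G \<in> graphs_on n \<Longrightarrow> \<not> eps_far \<epsilon> P G"
  shows "canonical_tester (3 / 4) (1 / 3) P n \<epsilon> 0 (\<lambda>H. return_pmf True)"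
  using assms unfolding canonical_tester_def
  by (auto simp: accept_prob_deterministic[where Q = "\<lambda>_. True"] n_subsets[of "{..<n}" 0, simplified])

lemma canonical_tester_exhaustive:
  assumes "1 \<le> n" "0 < \<epsilon>"
  shows "canonical_tester (3 / 4) (1 / 3) P n \<epsilon> n (\<lambda>H. return_pmf (H \<in> P))"
proof -
  have acc: "accept_prob n n (\<lambda>H. return_pmf (H \<in> P)) G = of_bool (G \<in> P)"
    if "G \<in> graphs_on n" for G
  proof -
    have "S \<subseteq> {..<n} \<and> card S = n \<longleftrightarrow> S = {..<n}" for S
      using card_subset_eq[of "{..<n}" S] by auto
    moreover have "induced_subgraph G {..<n} = G"
      using that by (auto simp: induced_subgraph_def graphs_on_def simple_graph_def prod_eq_iff)
    ultimately have "{S. S \<subseteq> {..<n} \<and> card S = n \<and> induced_subgraph G S \<in> P}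
        = {S. S = {..<n} \<and> G \<in> P}"
      by (intro Collect_cong) metis
    then show ?thesis by (simp add: accept_prob_deterministic[where Q = "\<lambda>H. H \<in> P"])
  qed
  have "G \<notin> P" if "G \<in> graphs_on n" "eps_far \<epsilon> P G" for G
  proof
    assume "G \<in> P"
    then have "\<epsilon> * (real n)\<^sup>2 \<le> 0" using that by (auto simp: eps_far_def graphs_on_def)
    then show False using assms by (simp add: mult_le_0_iff)
  qed
  then show ?thesis by (auto simp: canonical_tester_def acc)
qed

lemma canonical_tester_sampling:
  fixes \<rho> \<epsilon> \<mu> :: real and n k s :: nat
  assumes n: "1 \<le> n" and \<rho>: "0 < \<rho>" "\<rho> \<le> 1" and \<epsilon>: "0 < \<epsilon>"
    and k: "k = nat \<lceil>\<rho> * real n\<rceil>" "1 \<le> k" and s: "1 \<le> s" "s \<le> n"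
    and \<Lambda>: "1 \<le> \<Lambda>" "ln (4 * real n * real k / (\<epsilon> * (real n)\<^sup>2)) \<le> \<Lambda>"
    and \<mu>: "\<mu> = real k * real s / real n"
    and large: "16 * ln (real s) + 64 \<le> (\<epsilon> * (real n)\<^sup>2 / (16 * (real k)\<^sup>2 * \<Lambda>))\<^sup>2 * \<mu>"
  shows "canonical_tester (3 / 4) (1 / 3) (indep_set_property \<rho>) n \<epsilon> s
    (\<lambda>H. return_pmf (\<exists>I. independent_set H I \<and> \<mu> - 2 * sqrt \<mu> \<le> real (card I)))"
    (is "canonical_tester _ _ _ _ _ _ (\<lambda>H. return_pmf (?Q H))")
  unfolding canonical_tester_def
proof (intro conjI ballI impI)
  show "s \<le> n" by fact
  have N: "0 < real (n choose s)" using s by simp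
  have V: "finite {..<n}" "{..<n} \<noteq> {}" "s \<le> card {..<n}"
    using n s by (auto simp: lessThan_empty_iff)
  have \<mu>0: "0 < \<mu>" using n s k(2) by (simp add: \<mu>)
  have Q: "?Q (induced_subgraph G S)
      \<longleftrightarrow> (\<exists>I\<subseteq>S. (\<forall>u\<in>I. \<forall>v\<in>I. {u, v} \<notin> edges G) \<and> \<mu> - 2 * sqrt \<mu> \<le> real (card I))" for G S
  proof -
    have "independent_set (induced_subgraph G S) I
        \<longleftrightarrow> I \<subseteq> S \<and> (\<forall>u\<in>I. \<forall>v\<in>I. {u, v} \<notin> edges G)" for I
      by (auto simp: independent_set_def induced_subgraph_def)
    then show ?thesis by auto
  qed
  fix G assume G: "G \<in> graphs_on n"
  have VG: "verts G = {..<n}" using G by (simp add: graphs_on_def)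
  let ?acc = "{S. S \<subseteq> {..<n} \<and> card S = s \<and> ?Q (induced_subgraph G S)}"
  {
    assume "G \<in> indep_set_property \<rho>"
    then obtain I where I: "independent_set G I" "card I = k"
      using VG k by (auto simp: indep_set_property_def)
    then have IV: "I \<subseteq> {..<n}" using VG by (simp add: independent_set_def)
    let ?SS = "{S. S \<subseteq> {..<n} \<and> card S = s}"
    let ?bad = "{S. S \<subseteq> {..<n} \<and> card S = s \<and> real (card (S \<inter> I)) < \<mu> - 2 * sqrt \<mu>}"
    have "real (card ?bad) \<le> real (n choose s) / 4"
      using card_lower_tail_le[OF V IV] \<mu>0 I \<mu> by simp
    moreover have "card ?SS \<le> card (?acc \<union> ?bad)"
    proof (intro card_mono subsetI)
      fix S assume S: "S \<in> ?SS"
      have "?Q (induced_subgraph G S)" if "\<mu> - 2 * sqrt \<mu> \<le> real (card (S \<inter> I))"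
        unfolding Q using that I by (intro exI[of _ "S \<inter> I"]) (auto simp: independent_set_def)
      then show "S \<in> ?acc \<union> ?bad" using S by force
    qed simp
    then have "card ?SS \<le> card ?acc + card ?bad"
      using card_Un_le order_trans by blast
    then have "n choose s \<le> card ?acc + card ?bad"
      using n_subsets[of "{..<n}" s] by simp
    then have "real (n choose s) \<le> real (card ?acc) + real (card ?bad)"
      by (simp only: of_nat_le_iff flip: of_nat_add)
    ultimately have "3 / 4 * real (n choose s) \<le> real (card ?acc)" by linarith
    then show "3 / 4 \<le> accept_prob n s (\<lambda>H. return_pmf (?Q H)) G"
      using N unfolding accept_prob_deterministic[OF s(2)] by (simp add: pos_le_divide_eq)
  }
  {
    assume far: "eps_far \<epsilon> (indep_set_property \<rho>) G"
    interpret locally_dense_graph "{..<n}" "edges G" k "\<epsilon> * (real n)\<^sup>2"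
      unfolding k(1) by (rule eps_far_locally_dense[OF G far n \<epsilon> \<rho>(2)])
    have "real (card ?acc) \<le> real (n choose s) / 3"
      using card_samples_with_independent_set_le[of s \<Lambda> _ \<mu>, OF s(1) _ \<Lambda>(1) _ refl] s \<Lambda> \<mu> large
      unfolding Q by simp
    then show "accept_prob n s (\<lambda>H. return_pmf (?Q H)) G \<le> 1 / 3"
      using N unfolding accept_prob_deterministic[OF s(2)] by (simp add: pos_divide_le_eq)
  }
qed

theorem theorem1:
  shows "\<exists>\<delta>\<^sub>1 \<delta>\<^sub>2 c :: real. \<delta>\<^sub>1 > \<delta>\<^sub>2 \<and> c > 0 \<and>
    (\<forall>(n::nat) (\<rho>::real) (\<epsilon>::real).
       n \<ge> 1 \<longrightarrow> 0 < \<rho> \<longrightarrow> \<rho> \<le> 1 \<longrightarrow> \<epsilon> > 0 \<longrightarrow>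
       ereal_of_enat (sample_complexity \<delta>\<^sub>1 \<delta>\<^sub>2 (indep_set_property \<rho>) n \<epsilon>)
         \<le> ereal (c * (\<rho> ^ 3 / \<epsilon>\<^sup>2) * (max 0 (ln (1 / \<epsilon>))) ^ 3))"
proof (intro exI conjI allI impI)
  show "(1 / 3 :: real) < 3 / 4" "(0 :: real) < 2 ^ 27" by simp_all
  fix n :: nat and \<rho> \<epsilon> :: real
  assume n: "1 \<le> n" and \<rho>: "0 < \<rho>" "\<rho> \<le> 1" and \<epsilon>: "0 < \<epsilon>"
  define k where "k = nat \<lceil>\<rho> * real n\<rceil>"
  define R where "R = 2 ^ 27 * (\<rho> ^ 3 / \<epsilon>\<^sup>2) * (max 0 (ln (1 / \<epsilon>))) ^ 3"
  have R0: "0 \<le> R" using \<rho> by (simp add: R_def)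
  have "ereal_of_enat (sample_complexity (3 / 4) (1 / 3) (indep_set_property \<rho>) n \<epsilon>) \<le> ereal R"
  proof (cases "\<exists>G\<in>graphs_on n. eps_far \<epsilon> (indep_set_property \<rho>) G")
    case False
    then show ?thesis
      using R0 by (intro sample_complexity_le[OF canonical_tester_trivial]) auto
  next
    case True
    then obtain G where G: "G \<in> graphs_on n" "eps_far \<epsilon> (indep_set_property \<rho>) G" by blast
    interpret locally_dense_graph "{..<n}" "edges G" k "\<epsilon> * (real n)\<^sup>2"
      unfolding k_def by (rule eps_far_locally_dense[OF G n \<epsilon> \<rho>(2)])
    have kn: "k \<le> n" using k_le by simp
    have "0 < real k * (real k - 1)" using D_le D_pos by linarith
    then have k2: "2 \<le> k" by (cases "k = 0 \<or> k = 1") auto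
    have D: "\<epsilon> * (real n)\<^sup>2 \<le> (real k)\<^sup>2 / 2"
      using D_le by (simp add: power2_eq_square algebra_simps)
    define s where "s = nat \<lfloor>2 ^ 27 * (\<rho> ^ 3 / \<epsilon>\<^sup>2) * ln (1 / \<epsilon>) ^ 3\<rfloor>"
    note size = sample_size_sufficient[OF \<rho> \<epsilon> k_def k2 kn D s_def]
    have "0 \<le> ln (1 / \<epsilon>)" using size(1) \<epsilon> by simp
    then have R_eq: "R = 2 ^ 27 * (\<rho> ^ 3 / \<epsilon>\<^sup>2) * ln (1 / \<epsilon>) ^ 3" by (simp add: R_def max_def)
    show ?thesis
    proof (cases "s \<le> n")
      case True
      have "1 \<le> k" using k2 by simp
      show ?thesis
        by (rule sample_complexity_le[OF canonical_tester_sampling[OF n \<rho> \<epsilon> k_def \<open>1 \<le> k\<close>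
                size(2) True size(4,5) refl size(6)]])
          (use size(3) R_eq in simp)
    next
      case False
      then show ?thesis
        using size(3) R_eq
        by (intro sample_complexity_le[OF canonical_tester_exhaustive[OF n \<epsilon>]]) auto
    qed
  qed
  then show "ereal_of_enat (sample_complexity (3 / 4) (1 / 3) (indep_set_property \<rho>) n \<epsilon>)
      \<le> ereal (2 ^ 27 * (\<rho> ^ 3 / \<epsilon>\<^sup>2) * (max 0 (ln (1 / \<epsilon>))) ^ 3)"
    by (simp only: R_def)
qed

end
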